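(* There is an absolute constant $C>0$ such that the following holds for every even $n\in\mathbb{N}$. Let $Q_n$ be a random matrix sampled uniformly from the set of all $n\times n$ matrices with entries in $\{0,1\}$ each of whose rows sums to $n/2$. Then for every real $\eta\ge 2^{-n^{0.0001}}$, $$\Pr\left(s_n(Q_n)\le \eta\right)\le C\,\eta\, n^{2}.$$
   Context: For a real $n\times n$ matrix $M$, $s_n(M)=\inf_{x\in\mathbb{S}^{n-1}}\|Mx\|_2$ denotes its least singular value, where $\mathbb{S}^{n-1}$ is the Euclidean unit sphere in $\mathbb{R}^n$. *)

theory Defs
  imports "HOL-Probability.Probability_Mass_Function" "Jordan_Normal_Form.Matrix"
begin

text \<open>Vectors and matrices are those of Jordan-Normal-Form, since the dimension
  is quantified inside the statement, after the constant.\<close>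

definition l2_norm_vec :: "real Matrix.vec \<Rightarrow> real" where
  "l2_norm_vec x = L2_set (vec_index x) {0..<dim_vec x}"

definition unit_sphere_vec :: "nat \<Rightarrow> real Matrix.vec set" where
  "unit_sphere_vec n = {x \<in> carrier_vec n. l2_norm_vec x = 1}"

text \<open>For a matrix with no columns the sphere is empty and the value below is an
  unspecified real number.\<close>

definition least_singular_value :: "real Matrix.mat \<Rightarrow> real" where
  "least_singular_value M = (INF x\<in>unit_sphere_vec (dim_col M). l2_norm_vec (M *\<^sub>v x))"

definition row_regular_mats :: "nat \<Rightarrow> real Matrix.mat set" where
  "row_regular_mats n =
    {M \<in> carrier_mat n n.
       (\<forall>i<n. \<forall>j<n. M $$ (i, j) \<in> {0, 1}) \<and>
       (\<forall>i<n. (\<Sum>j<n. M $$ (i, j)) = real n / 2)}"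

text \<open>The uniform distribution \<open>pmf_of_set\<close> is only meaningful on a finite nonempty set.\<close>

lemma finite_row_regular_mats: "finite (row_regular_mats n)"
proof (rule finite_subset)
  let ?F = "({..<n} \<times> {..<n}) \<rightarrow>\<^sub>E {0, 1 :: real}"
  show "row_regular_mats n \<subseteq> Matrix.mat n n ` ?F"
  proof
    fix M assume M: "M \<in> row_regular_mats n"
    let ?f = "restrict (\<lambda>ij. M $$ ij) ({..<n} \<times> {..<n})"
    have "M = Matrix.mat n n ?f"
      using M unfolding row_regular_mats_def by (intro eq_matI) auto
    moreover have "?f \<in> ?F"
      using M unfolding row_regular_mats_def by (intro restrict_PiE_iff[THEN iffD2]) auto
    ultimately show "M \<in> Matrix.mat n n ` ?F" by blast
  qed
  show "finite (Matrix.mat n n ` ?F)"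
    by (intro finite_imageI finite_PiE) auto
qed

lemma row_regular_mats_nonempty:
  assumes "even n"
  shows "row_regular_mats n \<noteq> {}"
proof -
  obtain k where n: "n = 2 * k" using assms by (elim evenE)
  have "(\<Sum>j<n. if j < k then 1 else 0 :: real) = real n / 2"
  proof -
    have "{j. j < n \<and> j < k} = {..<k}" using n by auto
    then show ?thesis
      using n by (simp add: sum.If_cases Int_def)
  qed
  then have "Matrix.mat n n (\<lambda>(i, j). if j < k then 1 else 0) \<in> row_regular_mats n"
    by (simp add: row_regular_mats_def)
  then show ?thesis by blast
qed

end

theory Submission
  imports Defs "HOL-Real_Asymp.Real_Asymp" "Jordan_Normal_Form.Determinant"
begin

text \<open>
  A small singular value forces some row to be almost orthogonal to a unit normal \<open>x\<close> of the other
  rows, so it suffices to bound the small ball probabilities of \<open>\<langle>R, x\<rangle>\<close> for a random row \<open>R\<close>, for all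
  normals \<open>x\<close> of all but a tiny fraction of the configurations of the other rows. The characteristic
  function of \<open>\<langle>R, x\<rangle>\<close> is a coefficient of \<open>\<Prod>j. (1 + T cis (u x j))\<close>; it is negligible at \<open>u = 2 \<pi> \<theta>\<close> unless
  \<open>\<theta> x\<close>, up to a constant shift, is within \<open>sqrt K\<close> of the integer lattice. Take a nearly minimal such
  \<open>\<theta>\<close> above a small power of \<open>n\<close>. Rounding \<open>\<theta> x\<close> randomly, rather than to the
  nearest lattice point, produces an integer vector \<open>w\<close> that all the rows nearly annihilate up to a common constant, without any bound on the
  operator norm. Minimality of \<open>\<theta>\<close> makes \<open>\<langle>R, w\<rangle>\<close> spread out at the scale of the rounding error, and
  this gain, raised to the number of rows, beats the number of candidates \<open>w\<close>. If \<open>\<theta>\<close> is much smaller than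
  \<open>sqrt n\<close>, then \<open>x\<close> is instead close in \<open>\<ell>1\<close> norm to a constant vector, and rounding a larger multiple of
  \<open>x\<close> leaves so few candidates \<open>w\<close> that any nontrivial anticoncentration suffices.
\<close>

section \<open>Smooth small ball estimates\<close>

text \<open>Everything hinges on a comparison of exponents. The l1 distance from the shifted
  \<theta> x to the lattice is at most V = sqrt (n K), about sqrt n, and random rounding has
  variance linear in that distance, so a row misses its target by about sqrt V, close to n^(1/4).
  Near-minimality of \<theta> bounds the chance of this by about sqrt V \<theta>0 / \<theta> per
  row, against (1 + \<theta> / sqrt n)^n candidates up to a factor (C ln D)^n. The rows win once
  \<theta> exceeds n^(1/4) \<theta>0 by a power of n. Below a cut \<theta>1, the l1 distance d from
  x to a constant is of order V / \<theta>0 + \<theta>1; it must be below sqrt n by a power of n, so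
  that a multiple L with d << L << sqrt n exists. Hence \<theta>1 lies between n^(1/4) \<theta>0 and
  sqrt n, with polynomial room on both sides, while \<theta>0 is a power of n larger than sqrt K; it
  enters the final bound, where n^2 has room for it. The Fourier estimates carry additive errors
  such as exp (- sqrt K), which cap the usable \<theta> at D = 2 powr (n powr 0.0002); this is where
  the lower bound on \<eta> enters.\<close>

lemma cauchy_kernel_has_integral:
  fixes A v :: real
  assumes "A \<ge> 0"
  shows "((\<lambda>a. exp (-a) * cos (a * v)) has_integral
    (1 - exp (-A) * (cos (A * v) - v * sin (A * v))) / (1 + v\<^sup>2)) {0..A}"
proof -
  define c where "c = 1 / (1 + v\<^sup>2)"
  have c: "c * (1 + v\<^sup>2) = 1"
    using zero_le_power2[of v] unfolding c_def by (simp add: add_nonneg_eq_0_iff)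
  define F where "F a = c * (exp (-a) * (v * sin (a * v) - cos (a * v)))" for a
  have "(F has_vector_derivative exp (-a) * cos (a * v)) (at a within {0..A})" for a
  proof -
    have "(F has_real_derivative c * (exp (-a) * (v * (cos (a * v) * v) + sin (a * v) * v)
        - exp (-a) * (v * sin (a * v) - cos (a * v)))) (at a within {0..A})"
      unfolding F_def by (auto intro!: derivative_eq_intros simp: algebra_simps)
    also have "c * (exp (-a) * (v * (cos (a * v) * v) + sin (a * v) * v)
        - exp (-a) * (v * sin (a * v) - cos (a * v))) = (c * (1 + v\<^sup>2)) * (exp (-a) * cos (a * v))"
      by (simp add: algebra_simps power2_eq_square)
    finally show ?thesis by (simp add: c has_real_derivative_iff_has_vector_derivative)
  qed
  then have "((\<lambda>a. exp (-a) * cos (a * v)) has_integral (F A - F 0)) {0..A}"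
    using assms by (intro fundamental_theorem_of_calculus) auto
  moreover have "F A - F 0 = (1 - exp (-A) * (cos (A * v) - v * sin (A * v))) / (1 + v\<^sup>2)"
    by (simp add: F_def c_def diff_divide_distrib add_divide_distrib algebra_simps)
  ultimately show ?thesis by simp
qed

text \<open>The Cauchy kernel is the full integral of \<open>exp (-a) * cos (a * v)\<close> over the
  half-line; cutting it at \<open>A\<close> costs at most \<open>2 * exp (-A)\<close> uniformly in
  v. The cut is wanted because characteristic functions will be controlled only on a bounded range
  of frequencies.\<close>

lemma cauchy_kernel_le:
  fixes A v :: real
  assumes "A \<ge> 0"
  shows "1 / (1 + v\<^sup>2) \<le> integral {0..A} (\<lambda>a. exp (-a) * cos (a * v)) + 2 * exp (-A)"
proof -
  have pos: "1 + v\<^sup>2 > 0" by (simp add: add_pos_nonneg)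
  have "\<bar>v * sin (A * v)\<bar> \<le> \<bar>v\<bar>" by (simp add: abs_mult mult_left_le)
  then have "cos (A * v) - v * sin (A * v) \<le> 1 + \<bar>v\<bar>"
    using cos_le_one[of "A * v"] by linarith
  also have "1 + \<bar>v\<bar> \<le> 2 * (1 + v\<^sup>2)"
  proof -
    have "0 \<le> (\<bar>v\<bar> - 1/2)\<^sup>2" by simp
    then show ?thesis by (simp add: power2_diff) (simp add: power2_eq_square)
  qed
  finally have "exp (-A) * (cos (A * v) - v * sin (A * v)) \<le> 2 * exp (-A) * (1 + v\<^sup>2)"
    by (simp add: mult.assoc mult.left_commute)
  then have "exp (-A) * (cos (A * v) - v * sin (A * v)) / (1 + v\<^sup>2) \<le> 2 * exp (-A)"
    using pos by (simp add: pos_divide_le_eq)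
  moreover have "integral {0..A} (\<lambda>a. exp (-a) * cos (a * v))
     = 1 / (1 + v\<^sup>2) - exp (-A) * (cos (A * v) - v * sin (A * v)) / (1 + v\<^sup>2)"
    using integral_unique[OF cauchy_kernel_has_integral[OF assms]] by (simp add: diff_divide_distrib)
  ultimately show ?thesis by linarith
qed

text \<open>An Esseen inequality for the Cauchy kernel. Frequencies below \<open>u0\<close> are
  bounded trivially and cost \<open>r * u0\<close>, those up to \<open>A / r\<close> cost
  \<epsilon>, and the truncation of the kernel costs the rest.\<close>

lemma esseen_cauchy:
  fixes X :: "'a \<Rightarrow> real" and r A u0 \<epsilon> b :: real
  assumes H: "finite H" and r: "r > 0" and A: "A \<ge> 0" and u0: "u0 \<ge> 0" and \<epsilon>: "\<epsilon> \<ge> 0"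
    and char: "\<And>u. u0 \<le> u \<Longrightarrow> u \<le> A / r \<Longrightarrow> cmod (\<Sum>s\<in>H. cis (u * X s)) \<le> \<epsilon> * card H"
  shows "(\<Sum>s\<in>H. 1 / (1 + ((X s - b) / r)\<^sup>2)) \<le> card H * (r * u0 + \<epsilon> + 2 * exp (-A))"
proof -
  define g where "g a = (\<Sum>s\<in>H. exp (-a) * cos (a * ((X s - b) / r)))" for a
  \<comment> \<open>The integration variable is a = r u, so the trivial bound is used on [0, r u0],
    a range that may overrun the cut-off A.\<close>
  define c where "c = min A (r * u0)"
  have c: "0 \<le> c" "c \<le> A" "c \<le> r * u0" using A r u0 by (auto simp: c_def)
  define h where "h a = (if a \<in> cbox 0 c then real (card H) else 0) + \<epsilon> * card H * exp (-a)" for a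
  have g_int: "(g has_integral (\<Sum>s\<in>H. integral {0..A} (\<lambda>a. exp (-a) * cos (a * ((X s - b) / r))))) {0..A}"
    unfolding g_def
    by (intro has_integral_sum H integrable_integral) (use cauchy_kernel_has_integral[OF A] in blast)
  have g1: "g a \<le> card H" if "a \<ge> 0" for a
  proof -
    have "exp (-a) * cos (a * ((X s - b) / r)) \<le> 1" for s
    proof -
      have "exp (-a) * cos (a * ((X s - b) / r)) \<le> exp (-a) * 1" by (intro mult_left_mono) auto
      also have "\<dots> \<le> 1" using that by simp
      finally show ?thesis .
    qed
    then show ?thesis unfolding g_def using sum_bounded_above[of H _ "1::real"] by simp
  qed
  have g2: "g a \<le> \<epsilon> * card H * exp (-a)" if "r * u0 \<le> a" "a \<le> A" for a
  proof -
    have "(\<Sum>s\<in>H. cos (a * ((X s - b) / r))) = Re (cis (- a * b / r) * (\<Sum>s\<in>H. cis (a / r * X s)))"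
      by (simp add: sum_distrib_left cis_mult diff_divide_distrib right_diff_distrib del: Re_sum)
         (simp add: algebra_simps)
    also have "\<dots> \<le> cmod (cis (- a * b / r) * (\<Sum>s\<in>H. cis (a / r * X s)))" by (rule complex_Re_le_cmod)
    also have "\<dots> = cmod (\<Sum>s\<in>H. cis (a / r * X s))" by (simp add: norm_mult)
    also have "\<dots> \<le> \<epsilon> * card H"
      using that r by (intro char) (auto simp: field_simps)
    finally show ?thesis
      unfolding g_def sum_distrib_left[symmetric] by (simp add: mult.commute)
  qed
  have "((\<lambda>a. exp (-a)) has_integral (1 - exp (-A))) {0..A}"
    using cauchy_kernel_has_integral[OF A, of 0] by simp
  moreover have "((\<lambda>a. if a \<in> cbox 0 c then real (card H) else 0) has_integral (c * card H)) (cbox 0 A)"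
    using c by (intro has_integral_restrict_closed_subinterval has_integral_eq_rhs[OF has_integral_const]) auto
  ultimately have h_int: "(h has_integral (c * card H + \<epsilon> * card H * (1 - exp (-A)))) {0..A}"
    unfolding h_def by (intro has_integral_add has_integral_mult_right) auto
  have gh: "g a \<le> h a" if a: "a \<in> {0..A}" for a
  proof (cases "a \<le> c")
    case True
    then show ?thesis using g1[of a] a \<epsilon> by (auto simp: h_def intro: add_increasing2)
  next
    case False
    then have "r * u0 \<le> a" using a by (auto simp: c_def min_def split: if_splits)
    then show ?thesis using g2[of a] a False by (auto simp: h_def)
  qed
  have "(\<Sum>s\<in>H. 1 / (1 + ((X s - b) / r)\<^sup>2))
     \<le> (\<Sum>s\<in>H. integral {0..A} (\<lambda>a. exp (-a) * cos (a * ((X s - b) / r))) + 2 * exp (-A))"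
    by (intro sum_mono cauchy_kernel_le A)
  also have "\<dots> \<le> c * card H + \<epsilon> * card H * (1 - exp (-A)) + card H * (2 * exp (-A))"
    using has_integral_le[OF g_int h_int gh] by (simp add: sum.distrib)
  also have "\<dots> \<le> r * u0 * card H + \<epsilon> * card H * 1 + card H * (2 * exp (-A))"
    using c \<epsilon> by (intro add_mono mult_mono) auto
  finally show ?thesis by (simp add: algebra_simps)
qed

text \<open>The function \<open>cos x * exp (x^2 / 2)\<close> decreases on [0, pi/2], its derivative
  having the sign of x cos x - sin x; the rest is evenness.\<close>

lemma cos_le_exp_quadratic:
  fixes x :: real
  assumes "\<bar>x\<bar> \<le> pi / 2"
  shows "cos x \<le> exp (- x\<^sup>2 / 2)"
proof -
  have main: "cos x \<le> exp (- x\<^sup>2 / 2)" if x: "0 \<le> x" "x \<le> pi / 2" for x :: real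
  proof -
    have h: "y * cos y \<le> sin y" if y: "0 \<le> y" "y \<le> pi" for y :: real
    proof -
      have "sin 0 - 0 * cos 0 \<le> sin y - y * cos y"
      proof (rule DERIV_nonneg_imp_nondecreasing[OF y(1)])
        fix z assume z: "0 \<le> z" "z \<le> y"
        have "((\<lambda>z. sin z - z * cos z) has_real_derivative z * sin z) (at z)"
          by (auto intro!: derivative_eq_intros)
        moreover have "z * sin z \<ge> 0" using z y by (intro mult_nonneg_nonneg sin_ge_zero) auto
        ultimately show "\<exists>d. ((\<lambda>z. sin z - z * cos z) has_real_derivative d) (at z) \<and> 0 \<le> d" by blast
      qed
      then show ?thesis by simp
    qed
    have "cos x * exp (x\<^sup>2 / 2) \<le> cos 0 * exp (0\<^sup>2 / 2)"
    proof (rule DERIV_nonpos_imp_nonincreasing[OF x(1)])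
      fix z assume z: "0 \<le> z" "z \<le> x"
      have "((\<lambda>z. cos z * exp (z\<^sup>2 / 2)) has_real_derivative exp (z\<^sup>2 / 2) * (z * cos z - sin z)) (at z)"
        by (auto intro!: derivative_eq_intros simp: algebra_simps)
      moreover have "exp (z\<^sup>2 / 2) * (z * cos z - sin z) \<le> 0"
        using h[of z] z x by (intro mult_nonneg_nonpos) auto
      ultimately show "\<exists>d. ((\<lambda>z. cos z * exp (z\<^sup>2 / 2)) has_real_derivative d) (at z) \<and> d \<le> 0" by blast
    qed
    then show ?thesis by (simp add: exp_minus field_simps)
  qed
  show ?thesis
    using main[of "\<bar>x\<bar>"] assms by simp
qed

text \<open>The modulus equals 2 |cos (pi s)| with s the offset of t from the nearest integer, which
  decays like a Gaussian; the exponent pi^2 / 2 is lowered to 1 for convenience.\<close>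

lemma norm_one_plus_cis_le:
  fixes t :: real
  obtains k :: int where "cmod (1 + cis (2 * pi * t)) \<le> 2 * exp (- (t - k)\<^sup>2)"
proof -
  define k where "k = round t"
  define s where "s = t - k"
  have s: "\<bar>s\<bar> \<le> 1/2" unfolding s_def k_def using of_int_round_abs_le[of t] by (simp add: abs_minus_commute)
  have pis: "\<bar>pi * s\<bar> \<le> pi / 2"
    using mult_left_mono[OF s, of pi] by (simp add: abs_mult)
  have "cis (2 * pi * t) = cis (2 * pi * s)"
  proof -
    have "cis (2 * pi * t) = cis (2 * pi * s) * cis (2 * pi * k)"
      by (simp add: cis_mult s_def algebra_simps)
    also have "cis (2 * pi * k) = 1" by (rule cis_multiple_2pi) auto
    finally show ?thesis by simp
  qed
  have "1 + cis (2 * (pi * s)) = 2 * cos (pi * s) * cis (pi * s)"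
    unfolding complex_eq_iff by (auto simp: cos_double_cos sin_double power2_eq_square)
  then have "cmod (1 + cis (2 * pi * t)) = 2 * \<bar>cos (pi * s)\<bar>"
    using \<open>cis (2 * pi * t) = cis (2 * pi * s)\<close> by (simp add: norm_mult mult.assoc)
  also have "\<bar>cos (pi * s)\<bar> = cos (pi * s)"
    using pis by (intro abs_of_nonneg cos_ge_zero) linarith+
  also have "\<dots> \<le> exp (- (pi * s)\<^sup>2 / 2)"
    using pis by (rule cos_le_exp_quadratic)
  also have "\<dots> \<le> exp (- s\<^sup>2)"
  proof -
    have "2 \<le> pi\<^sup>2" using power_mono[OF pi_ge_two, of 2] by simp
    then have "2 * s\<^sup>2 \<le> pi\<^sup>2 * s\<^sup>2" by (intro mult_right_mono) auto
    then show ?thesis by (simp add: power_mult_distrib)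
  qed
  finally show ?thesis using that[of k] by (simp add: s_def)
qed

section \<open>Sums over random half-sets\<close>

definition half_sets :: "nat \<Rightarrow> nat set set" where
  "half_sets n = {S. S \<subseteq> {..<n} \<and> card S = n div 2}"

lemma finite_half_sets [simp]: "finite (half_sets n)"
  unfolding half_sets_def by (rule finite_subset[of _ "Pow {..<n}"]) auto

lemma half_sets_subset: "S \<in> half_sets n \<Longrightarrow> S \<subseteq> {..<n}"
  and card_half_set: "S \<in> half_sets n \<Longrightarrow> card S = n div 2"
  by (auto simp: half_sets_def)

lemma card_half_sets: "card (half_sets n) = n choose (n div 2)"
  using n_subsets[of "{..<n}" "n div 2"] by (simp add: half_sets_def)

lemma card_half_sets_pos: "card (half_sets n) > 0"
  by (simp add: card_half_sets)

text \<open>Restricting a uniform random subset to size n / 2 thus inflates averages by a factor of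
  n at most, which exponentially small bounds can afford.\<close>

lemma two_power_le_card_half_sets:
  assumes "even n" "n > 0"
  shows "2 ^ n \<le> real n * card (half_sets n)"
proof -
  obtain k where k: "n = 2 * k" using assms(1) by (elim evenE)
  then have "k > 0" using assms by simp
  then have "4 ^ k / (2 * real k) \<le> real ((2 * k) choose k)"
    by (rule central_binomial_lower_bound)
  moreover have "2 ^ (2 * k) = (4::real) ^ k" by (simp add: power_mult)
  ultimately show ?thesis using \<open>k > 0\<close> by (simp add: k card_half_sets field_simps)
qed

text \<open>Orthogonality of the roots of unity of order n + 1: two numbers in 0..n are congruent
  modulo n + 1 only if they are equal.\<close>

lemma sum_cis_roots:
  fixes s m n :: nat
  assumes "s \<le> n" "m \<le> n"
  shows "(\<Sum>k<n+1. cis (2 * pi * k * (real s - real m) / (n + 1))) = (if s = m then n + 1 else 0)"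
proof (cases "s = m")
  case False
  define a where "a = cis (2 * pi * (real s - real m) / (n + 1))"
  have "a \<noteq> 1"
  proof
    assume "a = 1"
    then have "cos (2 * pi * (real s - real m) / (n + 1)) = 1" by (simp add: a_def complex_eq_iff)
    then obtain i :: int where "2 * pi * (real s - real m) / (n + 1) = 2 * pi * i"
      by (auto simp: cos_one_2pi_int)
    then have "2 * pi * ((real s - real m) / (n + 1)) = 2 * pi * i" by simp
    then have "(real s - real m) / (n + 1) = i" by (subst (asm) mult_left_cancel) auto
    then have "real s - real m = of_int i * (real n + 1)" by (simp add: field_simps)
    then have "of_int (int s - int m) = (of_int (i * (int n + 1)) :: real)" by simp
    then have "int s - int m = i * (int n + 1)" by (simp only: of_int_eq_iff)
    moreover have "\<bar>int s - int m\<bar> < int n + 1" "int s - int m \<noteq> 0" using assms False by auto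
    ultimately have "\<bar>i\<bar> * (int n + 1) < int n + 1" "i \<noteq> 0" by (auto simp: abs_mult)
    moreover from this have "1 * (int n + 1) \<le> \<bar>i\<bar> * (int n + 1)"
      by (intro mult_right_mono) auto
    ultimately show False by (simp only: mult_1)
  qed
  have "a ^ (n + 1) = cis (2 * pi * (real s - real m))"
    by (simp add: a_def Complex.DeMoivre del: power_Suc)
  also have "\<dots> = 1" by (rule cis_multiple_2pi) auto
  finally have "(\<Sum>k<n+1. a ^ k) = 0" using \<open>a \<noteq> 1\<close> by (subst geometric_sum) auto
  moreover have "cis (2 * pi * k * (real s - real m) / (n + 1)) = a ^ k" for k
    by (simp add: a_def Complex.DeMoivre mult_ac)
  ultimately show ?thesis using False by simp
qed auto

text \<open>Coefficient extraction: the sum over subsets of a fixed size is a coefficient of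
  the polynomial \<open>\<Prod>j<n. (1 + T * z j)\<close>.\<close>

lemma norm_esymm_le:
  fixes z :: "nat \<Rightarrow> complex" and B :: real
  assumes m: "m \<le> n" and B: "\<And>\<alpha>. cmod (\<Prod>j<n. 1 + cis \<alpha> * z j) \<le> B"
  shows "cmod (\<Sum>S | S \<subseteq> {..<n} \<and> card S = m. \<Prod>j\<in>S. z j) \<le> B"
proof -
  \<comment> \<open>The polynomial in T has degree at most n, so averaging over the n + 1 roots of
    unity recovers one coefficient exactly, and an average does not exceed the maximum
    \<open>B\<close>. No factor is lost.\<close>
  define \<alpha> where "\<alpha> k = 2 * pi * real k / (n + 1)" for k :: nat
  let ?E = "\<Sum>S | S \<subseteq> {..<n} \<and> card S = m. \<Prod>j\<in>S. z j"
  have expand: "(\<Prod>j<n. 1 + cis (\<alpha> k) * z j)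
      = (\<Sum>S\<in>Pow {..<n}. cis (card S * \<alpha> k) * (\<Prod>j\<in>S. z j))" for k
  proof -
    have "(\<Prod>j<n. cis (\<alpha> k) * z j + 1)
       = (\<Sum>S\<in>Pow {..<n}. (\<Prod>j\<in>S. cis (\<alpha> k) * z j) * (\<Prod>j\<in>{..<n}-S. 1))"
      by (rule prod_add) auto
    also have "\<dots> = (\<Sum>S\<in>Pow {..<n}. cis (card S * \<alpha> k) * (\<Prod>j\<in>S. z j))"
      by (simp add: prod.distrib Complex.DeMoivre)
    finally show ?thesis by (simp add: add.commute)
  qed
  have "(\<Sum>k<n+1. cis (- (m * \<alpha> k)) * (\<Prod>j<n. 1 + cis (\<alpha> k) * z j))
     = (\<Sum>S\<in>Pow {..<n}. (\<Sum>k<n+1. cis (- (m * \<alpha> k)) * cis (card S * \<alpha> k)) * (\<Prod>j\<in>S. z j))"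
    unfolding expand sum_distrib_left sum_distrib_right
    by (subst sum.swap) (simp add: mult.assoc)
  also have "\<dots> = (\<Sum>S\<in>Pow {..<n}. (if card S = m then n + 1 else 0) * (\<Prod>j\<in>S. z j))"
  proof (intro sum.cong refl arg_cong2[where f = "(*)"])
    fix S assume "S \<in> Pow {..<n}"
    then have "card S \<le> n" using card_mono[of "{..<n}" S] by auto
    have "(\<Sum>k<n+1. cis (- (m * \<alpha> k)) * cis (card S * \<alpha> k))
       = (\<Sum>k<n+1. cis (2 * pi * k * (real (card S) - real m) / (n + 1)))"
      by (intro sum.cong refl) (simp add: cis_mult \<alpha>_def diff_divide_distrib algebra_simps)
    then show "(\<Sum>k<n+1. cis (- (m * \<alpha> k)) * cis (card S * \<alpha> k)) = (if card S = m then n + 1 else 0)"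
      using sum_cis_roots[OF \<open>card S \<le> n\<close> m] by simp
  qed
  also have "\<dots> = (n + 1) * ?E"
  proof -
    have "(\<Sum>S\<in>Pow {..<n}. (if card S = m then n + 1 else 0) * (\<Prod>j\<in>S. z j))
        = (\<Sum>S\<in>Pow {..<n}. if card S = m then (n + 1) * (\<Prod>j\<in>S. z j) else 0)"
      by (intro sum.cong) auto
    also have "\<dots> = (\<Sum>S | S \<in> Pow {..<n} \<and> card S = m. (n + 1) * (\<Prod>j\<in>S. z j))"
      by (rule sum.inter_filter[symmetric]) auto
    also have "{S. S \<in> Pow {..<n} \<and> card S = m} = {S. S \<subseteq> {..<n} \<and> card S = m}" by auto
    finally show ?thesis by (simp only: sum_distrib_left)
  qed
  finally have "(n + 1) * cmod ?E
     = cmod (\<Sum>k<n+1. cis (- (m * \<alpha> k)) * (\<Prod>j<n. 1 + cis (\<alpha> k) * z j))"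
    by (simp add: norm_mult del: sum.lessThan_Suc) (metis norm_of_nat of_nat_Suc)
  also have "\<dots> \<le> (\<Sum>k<n+1. B)"
    by (intro order.trans[OF norm_sum] sum_mono) (auto simp: norm_mult B)
  also have "\<dots> = (n + 1) * B" by simp
  finally show ?thesis by (simp add: mult_le_cancel_left)
qed

text \<open>The shift \<psi> reflects the free phase of T. It cannot be avoided: all half-sets have
  the same size, so adding a constant to y moves every sum over a half-set by the same
  amount.\<close>

definition near :: "nat \<Rightarrow> real \<Rightarrow> (nat \<Rightarrow> real) \<Rightarrow> bool" where
  "near n K y \<longleftrightarrow> (\<exists>\<psi>::real. \<exists>k::nat \<Rightarrow> int. (\<Sum>j<n. (y j + \<psi> - k j)\<^sup>2) \<le> K)"

text \<open>Each factor of the product is at most 2 exp of minus the squared distance from an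
  integer, so for every phase the product is at most 2^n exp (-K). Comparing 2^n with the number of
  half-sets gives the factor n.\<close>

lemma char_half_sets_le:
  assumes n: "even n" "n > 0" and far: "\<not> near n K (\<lambda>j. u / (2 * pi) * w j)"
  shows "cmod (\<Sum>S\<in>half_sets n. cis (u * sum w S)) \<le> n * exp (-K) * card (half_sets n)"
proof -
  have "cmod (\<Prod>j<n. 1 + cis \<alpha> * cis (u * w j)) \<le> 2 ^ n * exp (-K)" for \<alpha>
  proof -
    define t where "t j = u / (2 * pi) * w j + \<alpha> / (2 * pi)" for j
    have t: "2 * pi * t j = \<alpha> + u * w j" for j by (simp add: t_def distrib_left)
    have "\<exists>k::int. cmod (1 + cis (2 * pi * t j)) \<le> 2 * exp (- (t j - k)\<^sup>2)" for j
      using norm_one_plus_cis_le by blast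
    then obtain k :: "nat \<Rightarrow> int" where k: "\<And>j. cmod (1 + cis (2 * pi * t j)) \<le> 2 * exp (- (t j - k j)\<^sup>2)"
      by metis
    have "cmod (\<Prod>j<n. 1 + cis \<alpha> * cis (u * w j)) = (\<Prod>j<n. cmod (1 + cis (2 * pi * t j)))"
      unfolding prod_norm[symmetric] by (simp only: cis_mult t)
    also have "\<dots> \<le> (\<Prod>j<n. 2 * exp (- (t j - k j)\<^sup>2))"
      by (intro prod_mono) (auto simp: k)
    also have "\<dots> = 2 ^ n * exp (- (\<Sum>j<n. (t j - k j)\<^sup>2))"
      by (simp add: prod.distrib exp_sum sum_negf[symmetric])
    also have "\<dots> \<le> 2 ^ n * exp (- K)"
    proof -
      have "K < (\<Sum>j<n. (t j - k j)\<^sup>2)"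
        using far unfolding near_def t_def not_ex not_le by blast
      then show ?thesis by simp
    qed
    finally show ?thesis .
  qed
  then have "cmod (\<Sum>S | S \<subseteq> {..<n} \<and> card S = n div 2. \<Prod>j\<in>S. cis (u * w j)) \<le> 2 ^ n * exp (-K)"
    by (intro norm_esymm_le) auto
  moreover have "(\<Sum>S | S \<subseteq> {..<n} \<and> card S = n div 2. \<Prod>j\<in>S. cis (u * w j))
     = (\<Sum>S\<in>half_sets n. cis (u * sum w S))"
    unfolding half_sets_def sum_distrib_left cis_conv_exp
    by (intro sum.cong refl, subst exp_sum[symmetric]) (auto intro: finite_subset simp: sum_distrib_left)
  ultimately have "cmod (\<Sum>S\<in>half_sets n. cis (u * sum w S)) \<le> 2 ^ n * exp (-K)" by simp
  also have "\<dots> \<le> (real n * card (half_sets n)) * exp (-K)"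
    by (intro mult_right_mono two_power_le_card_half_sets n) auto
  finally show ?thesis by (simp add: mult_ac)
qed

text \<open>A smoothed concentration function at scale r. The Cauchy kernel serves twice: it has an
  explicit Fourier representation, and it dominates exp (- x^2), so that estimates for single rows
  multiply.\<close>

definition smooth_conc :: "nat \<Rightarrow> real \<Rightarrow> (nat \<Rightarrow> real) \<Rightarrow> real \<Rightarrow> real" where
  "smooth_conc n r w b = (\<Sum>S\<in>half_sets n. 1 / (1 + ((sum w S - b) / r)\<^sup>2)) / card (half_sets n)"

text \<open>The frequency is u = 2 pi v, so that the vector compared with the lattice is v w
  itself.\<close>

lemma smooth_conc_le:
  assumes "even n" "n > 0" "r > 0" "A \<ge> 0" "v0 \<ge> 0"
    and far: "\<And>v. v0 \<le> v \<Longrightarrow> v \<le> A / (2 * pi * r) \<Longrightarrow> \<not> near n K (\<lambda>j. v * w j)"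
  shows "smooth_conc n r w b \<le> 2 * pi * r * v0 + n * exp (-K) + 2 * exp (-A)"
proof -
  have "(\<Sum>S\<in>half_sets n. 1 / (1 + ((sum w S - b) / r)\<^sup>2))
     \<le> card (half_sets n) * (r * (2 * pi * v0) + n * exp (-K) + 2 * exp (-A))"
  proof (rule esseen_cauchy)
    fix u assume u: "2 * pi * v0 \<le> u" "u \<le> A / r"
    have "\<not> near n K (\<lambda>j. u / (2 * pi) * w j)"
    proof (rule far)
      show "v0 \<le> u / (2 * pi)" using u by (subst pos_le_divide_eq) (auto simp: mult_ac)
      have "u / (2 * pi) \<le> A / r / (2 * pi)" using u by (intro divide_right_mono) auto
      then show "u / (2 * pi) \<le> A / (2 * pi * r)" by (simp add: mult_ac)
    qed
    then show "cmod (\<Sum>S\<in>half_sets n. cis (u * sum w S)) \<le> n * exp (-K) * card (half_sets n)"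
      using assms(1,2) by (intro char_half_sets_le)
  qed (use assms in auto)
  then show ?thesis
    unfolding smooth_conc_def using card_half_sets_pos[of n]
    by (simp add: pos_divide_le_eq mult_ac)
qed

lemma smooth_conc_nonneg: "smooth_conc n r w b \<ge> 0"
  unfolding smooth_conc_def by (intro divide_nonneg_nonneg sum_nonneg) (auto intro: add_nonneg_nonneg)

lemma small_ball_le_smooth_conc:
  assumes "r > 0"
  shows "card {S\<in>half_sets n. \<bar>sum w S\<bar> \<le> r} \<le> 2 * smooth_conc n r w 0 * card (half_sets n)"
proof -
  have "real (card {S\<in>half_sets n. \<bar>sum w S\<bar> \<le> r}) = (\<Sum>S\<in>half_sets n. if \<bar>sum w S\<bar> \<le> r then 1 else 0)"
    by (simp add: sum.If_cases Int_def)
  also have "\<dots> \<le> (\<Sum>S\<in>half_sets n. 2 * (1 / (1 + ((sum w S - 0) / r)\<^sup>2)))"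
  proof (intro sum_mono)
    fix S
    have "((sum w S) / r)\<^sup>2 \<le> 1" if "\<bar>sum w S\<bar> \<le> r"
      using that assms by (simp add: abs_square_le_1)
    moreover have "1 + ((sum w S) / r)\<^sup>2 > 0" by (simp add: add_pos_nonneg)
    ultimately show "(if \<bar>sum w S\<bar> \<le> r then 1 else 0) \<le> 2 * (1 / (1 + ((sum w S - 0) / r)\<^sup>2))"
      by (auto simp: field_simps)
  qed
  also have "\<dots> = 2 * smooth_conc n r w 0 * card (half_sets n)"
    unfolding smooth_conc_def sum_distrib_left[symmetric] using card_half_sets_pos[of n] by simp
  finally show ?thesis .
qed

section \<open>Rounding and tensorization\<close>

text \<open>Rounding the coordinates of \<open>y\<close> one at a time; the two candidates average to zero
  error, so some choice does not exceed the expected quadratic cost.\<close>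

lemma round_step:
  fixes y :: real and a c :: "'i \<Rightarrow> real"
  assumes "finite I" and V: "\<bar>y - of_int k\<bar> \<le> V"
  shows "\<exists>m::int. (\<Sum>i\<in>I. (c i + (m - y) * a i)\<^sup>2) \<le> (\<Sum>i\<in>I. (c i)\<^sup>2) + V * (\<Sum>i\<in>I. (a i)\<^sup>2)"
proof -
  define f where "f = \<lfloor>y\<rfloor>"
  define p where "p = y - f"
  have p: "0 \<le> p" "p < 1" by (auto simp: p_def f_def) linarith
  define G where "G e = (\<Sum>i\<in>I. (c i + e * a i)\<^sup>2)" for e
  let ?C = "\<Sum>i\<in>I. (c i)\<^sup>2" and ?B = "\<Sum>i\<in>I. c i * a i" and ?D = "\<Sum>i\<in>I. (a i)\<^sup>2"
  have G: "G e = ?C + 2 * e * ?B + e\<^sup>2 * ?D" for e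
    by (simp add: G_def power2_sum power_mult_distrib sum.distrib sum_distrib_left algebra_simps)
  have avg: "(1 - p) * G (- p) + p * G (1 - p) = ?C + p * (1 - p) * ?D"
    unfolding G by (simp add: algebra_simps power2_eq_square)
  \<comment> \<open>This is the variance of the two-point rounding. It is at most the distance of y
    to the integers, hence at most |y - k| for every integer k. The bound is linear, not quadratic,
    in that distance, and so l1 distances govern the cost of rounding.\<close>
  have "p * (1 - p) \<le> V"
  proof -
    have "k \<le> f \<or> f + 1 \<le> k" by linarith
    then have "p \<le> \<bar>y - k\<bar> \<or> 1 - p \<le> \<bar>y - k\<bar>"
    proof
      assume "k \<le> f" then have "real_of_int k \<le> f" by simp
      then show ?thesis using p by (auto simp: p_def)
    next
      assume "f + 1 \<le> k" then have "real_of_int f + 1 \<le> k" by linarith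
      then show ?thesis using p by (auto simp: p_def)
    qed
    moreover have "p * (1 - p) \<le> p" "p * (1 - p) \<le> 1 - p"
      using p by (auto simp: mult_left_le mult_left_le_one_le)
    ultimately show ?thesis using V by linarith
  qed
  then have "p * (1 - p) * ?D \<le> V * ?D" by (intro mult_right_mono sum_nonneg) auto
  then have le: "(1 - p) * G (- p) + p * G (1 - p) \<le> ?C + V * ?D" using avg by linarith
  have "G (- p) \<le> ?C + V * ?D \<or> G (1 - p) \<le> ?C + V * ?D"
  proof (rule ccontr)
    assume "\<not> ?thesis"
    then have *: "G (- p) > ?C + V * ?D" "G (1 - p) > ?C + V * ?D" by auto
    have "(1 - p) * G (- p) > (1 - p) * (?C + V * ?D)" using * p by (intro mult_strict_left_mono) auto
    moreover have "p * G (1 - p) \<ge> p * (?C + V * ?D)" using * p by (intro mult_left_mono) auto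
    ultimately show False using le by (simp add: algebra_simps)
  qed
  then show ?thesis
  proof
    assume "G (- p) \<le> ?C + V * ?D"
    then show ?thesis by (intro exI[of _ f]) (simp add: G_def p_def)
  next
    assume "G (1 - p) \<le> ?C + V * ?D"
    moreover have "1 - p = of_int (f + 1) - y" by (simp add: p_def)
    ultimately show ?thesis by (intro exI[of _ "f + 1"]) (simp only: G_def)
  qed
qed

text \<open>A greedy derandomization: fixing one coordinate adds at most its own variance to the
  total over all forms, without cross terms. Only the column weights of a enter, never its operator
  norm.\<close>

lemma round_forms:
  fixes y :: "'j \<Rightarrow> real" and a :: "'i \<Rightarrow> 'j \<Rightarrow> real" and k :: "'j \<Rightarrow> int"
  assumes "finite J" "finite I"
  shows "\<exists>m::'j \<Rightarrow> int. (\<Sum>i\<in>I. (\<Sum>j\<in>J. (m j - y j) * a i j)\<^sup>2)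
     \<le> (\<Sum>j\<in>J. \<bar>y j - k j\<bar> * (\<Sum>i\<in>I. (a i j)\<^sup>2))"
  using assms(1)
proof (induction J rule: finite_induct)
  case (insert x J)
  then obtain m :: "'j \<Rightarrow> int" where m: "(\<Sum>i\<in>I. (\<Sum>j\<in>J. (m j - y j) * a i j)\<^sup>2)
     \<le> (\<Sum>j\<in>J. \<bar>y j - k j\<bar> * (\<Sum>i\<in>I. (a i j)\<^sup>2))" by blast
  obtain q :: int where q: "(\<Sum>i\<in>I. ((\<Sum>j\<in>J. (m j - y j) * a i j) + (q - y x) * a i x)\<^sup>2)
     \<le> (\<Sum>i\<in>I. (\<Sum>j\<in>J. (m j - y j) * a i j)\<^sup>2) + \<bar>y x - k x\<bar> * (\<Sum>i\<in>I. (a i x)\<^sup>2)"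
    using round_step[OF assms(2) order.refl, where y = "y x" and k = "k x"
        and c = "\<lambda>i. \<Sum>j\<in>J. (m j - y j) * a i j" and a = "\<lambda>i. a i x"] by blast
  have eq: "(\<Sum>j\<in>insert x J. ((m(x := q)) j - y j) * a i j) = (\<Sum>j\<in>J. (m j - y j) * a i j) + (q - y x) * a i x" for i
  proof -
    have "(\<Sum>j\<in>J. ((m(x := q)) j - y j) * a i j) = (\<Sum>j\<in>J. (m j - y j) * a i j)"
      using insert.hyps by (intro sum.cong) auto
    then show ?thesis using insert.hyps by simp
  qed
  have "(\<Sum>i\<in>I. (\<Sum>j\<in>insert x J. ((m(x := q)) j - y j) * a i j)\<^sup>2)
    \<le> (\<Sum>j\<in>insert x J. \<bar>y j - k j\<bar> * (\<Sum>i\<in>I. (a i j)\<^sup>2))"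
    unfolding eq using q m insert.hyps by simp
  then show ?case by blast
qed auto

lemma round_sets:
  fixes y :: "nat \<Rightarrow> real" and k :: "nat \<Rightarrow> int" and S :: "'i \<Rightarrow> nat set"
  assumes I: "finite I" "card I \<le> n" and S: "\<And>i. i \<in> I \<Longrightarrow> S i \<subseteq> {..<n}"
    and V: "(\<Sum>j<n. \<bar>y j - k j\<bar>) \<le> V"
  shows "\<exists>m::nat \<Rightarrow> int. (\<Sum>i\<in>I. (\<Sum>j\<in>S i. m j - y j)\<^sup>2) \<le> 2 * n * V \<and> (\<Sum>j<n. (m j - y j)\<^sup>2) \<le> 2 * V"
proof (cases "n = 0")
  case True
  then have "S i = {}" if "i \<in> I" for i using S[OF that] by auto
  then show ?thesis using True V by simp
next
  case False
  \<comment> \<open>Two families of forms are controlled at once: the sums over the sets, and the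
    single coordinates. The latter carry weight sqrt n, so each family contributes at most n to
    every column weight.\<close>
  define a where "a z j = (case z of Inl i \<Rightarrow> if j \<in> S i then 1 else 0
      | Inr l \<Rightarrow> if j = l then sqrt n else 0)" for z :: "'i + nat" and j
  obtain m :: "nat \<Rightarrow> int" where m: "(\<Sum>z\<in>I <+> {..<n}. (\<Sum>j<n. (m j - y j) * a z j)\<^sup>2)
     \<le> (\<Sum>j<n. \<bar>y j - k j\<bar> * (\<Sum>z\<in>I <+> {..<n}. (a z j)\<^sup>2))"
    using round_forms[of "{..<n}" "I <+> {..<n}" y a k] I by auto
  have "(\<Sum>j<n. \<bar>y j - k j\<bar> * (\<Sum>z\<in>I <+> {..<n}. (a z j)\<^sup>2)) \<le> (\<Sum>j<n. \<bar>y j - k j\<bar> * (2 * n))"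
  proof (intro sum_mono mult_left_mono)
    fix j assume "j \<in> {..<n}"
    have "(\<Sum>z\<in>I <+> {..<n}. (a z j)\<^sup>2) = (\<Sum>i\<in>I. (if j \<in> S i then 1 else 0)\<^sup>2) + (\<Sum>l<n. (if j = l then sqrt n else 0)\<^sup>2)"
      using I by (simp add: sum.Plus a_def)
    also have "(\<Sum>i\<in>I. (if j \<in> S i then 1 else 0)\<^sup>2) \<le> (\<Sum>i\<in>I. 1::real)" by (intro sum_mono) auto
    also have "(\<Sum>l<n. (if j = l then sqrt n else 0)\<^sup>2) = n"
      using \<open>j \<in> {..<n}\<close> by (simp add: if_distrib[of "\<lambda>c. c\<^sup>2"] cong: if_cong)
    finally show "(\<Sum>z\<in>I <+> {..<n}. (a z j)\<^sup>2) \<le> 2 * n" using I by simp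
  qed auto
  also have "\<dots> = (\<Sum>j<n. \<bar>y j - k j\<bar>) * (2 * n)" by (simp only: sum_distrib_right)
  also have "\<dots> \<le> V * (2 * n)" using V by (intro mult_right_mono) auto
  finally have le: "(\<Sum>z\<in>I <+> {..<n}. (\<Sum>j<n. (m j - y j) * a z j)\<^sup>2) \<le> 2 * n * V"
    using m by (simp add: mult_ac)
  have "(\<Sum>j<n. (m j - y j) * a (Inl i) j) = (\<Sum>j\<in>S i. m j - y j)" if "i \<in> I" for i
    using S[OF that] by (simp add: a_def if_distrib[of "(*) _"] sum.If_cases Int_absorb1 cong: if_cong)
  moreover have "((\<Sum>j<n. (m j - y j) * a (Inr l) j)\<^sup>2) = n * (m l - y l)\<^sup>2" if "l < n" for l
    using that by (simp add: a_def if_distrib[of "(*) _"] power_mult_distrib cong: if_cong)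
  ultimately have "(\<Sum>i\<in>I. (\<Sum>j\<in>S i. m j - y j)\<^sup>2) + n * (\<Sum>l<n. (m l - y l)\<^sup>2) \<le> 2 * n * V"
    using le I by (simp add: sum.Plus sum_distrib_left)
  moreover have "0 \<le> (\<Sum>i\<in>I. (\<Sum>j\<in>S i. m j - y j)\<^sup>2)" "0 \<le> n * (\<Sum>l<n. (m l - y l)\<^sup>2)"
    by (auto intro!: sum_nonneg mult_nonneg_nonneg)
  ultimately have "(\<Sum>i\<in>I. (\<Sum>j\<in>S i. m j - y j)\<^sup>2) \<le> 2 * n * V" "n * (\<Sum>l<n. (m l - y l)\<^sup>2) \<le> n * (2 * V)"
    by linarith+
  then show ?thesis using False by (intro exI[of _ m]) auto
qed

text \<open>An exponential Markov inequality: on the event, 1 is at most exp (M / r^2) times a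
  product of Gaussians, and exp (- x^2) \<le> 1 / (1 + x^2) turns this into a product whose sum
  factorizes over the rows. With M of order n r^2 the loss is only exponential in n.\<close>

lemma tensorize:
  fixes w :: "nat \<Rightarrow> real" and I :: "'i set"
  assumes I: "finite I" and r: "r > 0"
  shows "card {G \<in> I \<rightarrow>\<^sub>E half_sets n. (\<Sum>i\<in>I. (sum w (G i) - b)\<^sup>2) \<le> M}
     \<le> exp (M / r\<^sup>2) * (smooth_conc n r w b * card (half_sets n)) ^ card I"
proof -
  let ?P = "I \<rightarrow>\<^sub>E half_sets n"
  define q where "q S = 1 / (1 + ((sum w S - b) / r)\<^sup>2)" for S
  have q0: "q S \<ge> 0" for S unfolding q_def by (intro divide_nonneg_nonneg add_nonneg_nonneg) auto
  have q1: "exp (- ((sum w S - b) / r)\<^sup>2) \<le> q S" for S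
    unfolding q_def exp_minus inverse_eq_divide
    by (intro divide_left_mono exp_ge_add_one_self) (auto intro!: mult_pos_pos add_pos_nonneg)
  have fin: "finite ?P" using I by (intro finite_PiE) auto
  have "real (card {G \<in> ?P. (\<Sum>i\<in>I. (sum w (G i) - b)\<^sup>2) \<le> M})
     = (\<Sum>G\<in>?P. if (\<Sum>i\<in>I. (sum w (G i) - b)\<^sup>2) \<le> M then 1 else 0)"
    using fin by (simp add: sum.If_cases Int_def)
  also have "\<dots> \<le> (\<Sum>G\<in>?P. exp (M / r\<^sup>2) * (\<Prod>i\<in>I. q (G i)))"
  proof (intro sum_mono)
    fix G
    have "1 \<le> exp (M / r\<^sup>2) * (\<Prod>i\<in>I. q (G i))" if "(\<Sum>i\<in>I. (sum w (G i) - b)\<^sup>2) \<le> M"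
    proof -
      have "(\<Sum>i\<in>I. ((sum w (G i) - b) / r)\<^sup>2) \<le> M / r\<^sup>2"
        using that by (simp add: power_divide sum_divide_distrib[symmetric] divide_right_mono)
      then have "1 \<le> exp (M / r\<^sup>2) * exp (- (\<Sum>i\<in>I. ((sum w (G i) - b) / r)\<^sup>2))"
        by (simp add: exp_add[symmetric])
      also have "exp (- (\<Sum>i\<in>I. ((sum w (G i) - b) / r)\<^sup>2)) = (\<Prod>i\<in>I. exp (- ((sum w (G i) - b) / r)\<^sup>2))"
        using I by (simp add: exp_sum sum_negf[symmetric])
      also have "\<dots> \<le> (\<Prod>i\<in>I. q (G i))" by (intro prod_mono) (auto simp: q1)
      finally show ?thesis by simp
    qed
    then show "(if (\<Sum>i\<in>I. (sum w (G i) - b)\<^sup>2) \<le> M then 1 else 0) \<le> exp (M / r\<^sup>2) * (\<Prod>i\<in>I. q (G i))"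
      using q0 by (auto intro!: mult_nonneg_nonneg prod_nonneg)
  qed
  also have "\<dots> = exp (M / r\<^sup>2) * (\<Prod>i\<in>I. \<Sum>S\<in>half_sets n. q S)"
    using I by (subst prod_sum_PiE) (auto simp: sum_distrib_left)
  also have "(\<Sum>S\<in>half_sets n. q S) = smooth_conc n r w b * card (half_sets n)"
    using card_half_sets_pos[of n] by (simp add: smooth_conc_def q_def)
  finally show ?thesis by simp
qed

section \<open>Anticoncentration from one pair of distant coordinates\<close>

text \<open>With n = 2 m, exactly twice (2 m - 2 choose m - 1) half-sets contain just one of j and
  k, and Pascal's rule shows that (2 m choose m) is at most four times that binomial
  coefficient.\<close>

lemma card_half_sets_separating:
  assumes "even n" "j < n" "k < n" "j \<noteq> k"
  shows "card (half_sets n) \<le> 2 * card {S\<in>half_sets n. (j \<in> S) \<noteq> (k \<in> S)}"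
proof -
  obtain m where n: "n = 2 * m" using assms(1) by (elim evenE)
  have m: "m \<ge> 1" using assms n by simp
  have choose: "card {T. T \<subseteq> A \<and> card T = c} = card A choose c" if "finite A" for A :: "nat set" and c
    using n_subsets[OF that] by simp
  define R where "R = {..<n} - {j, k}"
  have R: "finite R" "card R = 2 * m - 2" "j \<notin> R" "k \<notin> R" using assms n by (auto simp: R_def)
  have part: "card {S\<in>half_sets n. a \<in> S \<and> b \<notin> S} = (2 * m - 2) choose (m - 1)"
    if ab: "{a, b} = {j, k}" "a \<noteq> b" for a b
  proof -
    have aR: "a \<notin> R" "b \<notin> R" using ab R by auto
    have ins: "{..<n} = insert a (insert b R)" using ab assms by (auto simp: R_def)
    have "{S\<in>half_sets n. a \<in> S \<and> b \<notin> S} = insert a ` {T. T \<subseteq> R \<and> card T = m - 1}"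
    proof (rule equalityI; rule subsetI)
      fix S assume S: "S \<in> {S\<in>half_sets n. a \<in> S \<and> b \<notin> S}"
      then have "S \<subseteq> {..<n}" "card S = m" "a \<in> S" "b \<notin> S" by (auto simp: half_sets_def n)
      then have "S - {a} \<subseteq> R" "card (S - {a}) = m - 1" "S = insert a (S - {a})"
        unfolding ins by auto
      then show "S \<in> insert a ` {T. T \<subseteq> R \<and> card T = m - 1}" by blast
    next
      fix S assume "S \<in> insert a ` {T. T \<subseteq> R \<and> card T = m - 1}"
      then obtain T where T: "T \<subseteq> R" "card T = m - 1" "S = insert a T" by auto
      then have "card S = m" using aR m finite_subset[OF T(1) R(1)] by (subst T(3), subst card_insert_disjoint) auto
      then show "S \<in> {S\<in>half_sets n. a \<in> S \<and> b \<notin> S}"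
        using T aR ab(2) by (auto simp: half_sets_def n ins[unfolded n])
    qed
    moreover have "inj_on (insert a) {T. T \<subseteq> R \<and> card T = m - 1}"
      using aR by (intro inj_onI) (metis (mono_tags, lifting) insert_ident mem_Collect_eq subsetD)
    ultimately show ?thesis using choose[OF R(1)] R(2) by (simp add: card_image)
  qed
  have "{S\<in>half_sets n. (j \<in> S) \<noteq> (k \<in> S)} = {S\<in>half_sets n. j \<in> S \<and> k \<notin> S} \<union> {S\<in>half_sets n. k \<in> S \<and> j \<notin> S}"
    by auto
  then have sep: "card {S\<in>half_sets n. (j \<in> S) \<noteq> (k \<in> S)} = 2 * ((2 * m - 2) choose (m - 1))"
    using part[of j k] part[of k j] assms(4) by (subst \<open>_ = _ \<union> _\<close>, subst card_Un_disjoint) auto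
  obtain q where q: "m = Suc q" using m by (cases m) auto
  have "(2 * m) choose m \<le> 4 * ((2 * m - 2) choose (m - 1))"
  proof -
    have "(2 * q + 1) choose q = (2 * q + 1) choose Suc q"
      using binomial_symmetric[of q "2 * q + 1"] by simp
    then have "(2 * m) choose m = 2 * ((2 * q + 1) choose Suc q)"
      by (simp add: q)
    also have "(2 * q + 1) choose Suc q = (2 * q choose q) + (2 * q choose Suc q)" by simp
    also have "2 * q choose Suc q \<le> 2 * q choose q"
      using binomial_maximum[of "2 * q" "Suc q"] by simp
    finally show ?thesis by (simp add: q)
  qed
  then show ?thesis using sep by (simp add: card_half_sets n)
qed

text \<open>Exchanging \<open>j\<close> and \<open>k\<close> pairs up the half-sets that separate them, and the two
  members of a pair cannot both have a sum close to \<open>b\<close>.\<close>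

lemma smooth_conc_le_of_gap:
  assumes n: "even n" and jk: "j < n" "k < n" and r: "r > 0" and gap: "\<bar>w j - w k\<bar> > 2 * r"
  shows "smooth_conc n r w b \<le> 7 / 8"
proof -
  have "j \<noteq> k" using gap r by auto
  define X where "X = {S\<in>half_sets n. (j \<in> S) \<noteq> (k \<in> S)}"
  define Y where "Y = {S\<in>X. \<bar>sum w S - b\<bar> \<le> r}"
  have finX: "finite X" by (simp add: X_def)
  define \<sigma> where "\<sigma> = Transposition.transpose j k"
  have \<sigma>: "inj \<sigma>" by (simp add: \<sigma>_def)
  have img: "\<sigma> ` S \<in> X" "\<bar>sum w (\<sigma> ` S) - sum w S\<bar> = \<bar>w j - w k\<bar>" if S: "S \<in> X" for S
  proof -
    have Ssub: "S \<subseteq> {..<n}" "card S = n div 2" and sep: "(j \<in> S) \<noteq> (k \<in> S)"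
      using S by (auto simp: X_def half_sets_def)
    have fS: "finite S" using Ssub finite_subset by blast
    have mem: "x \<in> \<sigma> ` S \<longleftrightarrow> \<sigma> x \<in> S" for x
      unfolding \<sigma>_def by (metis image_iff transpose_involutory)
    have "\<sigma> ` S \<subseteq> {..<n}" using Ssub jk by (auto simp: \<sigma>_def Transposition.transpose_def)
    moreover have "card (\<sigma> ` S) = n div 2" using Ssub \<sigma> by (simp add: card_image inj_on_subset)
    moreover have "(j \<in> \<sigma> ` S) \<noteq> (k \<in> \<sigma> ` S)" using sep unfolding mem by (auto simp: \<sigma>_def)
    ultimately show "\<sigma> ` S \<in> X" by (simp add: X_def half_sets_def)
    have "sum w (\<sigma> ` S) = (\<Sum>i\<in>S. w (\<sigma> i))" using \<sigma> by (subst sum.reindex) (auto intro: inj_on_subset)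
    also have "\<dots> - sum w S = (\<Sum>i\<in>S. w (\<sigma> i) - w i)" by (simp add: sum_subtractf)
    also have "\<dots> = (\<Sum>i\<in>S \<inter> {j, k}. w (\<sigma> i) - w i)"
      using fS by (intro sum.mono_neutral_right) (auto simp: \<sigma>_def Transposition.transpose_def)
    finally have *: "sum w (\<sigma> ` S) - sum w S = (\<Sum>i\<in>S \<inter> {j, k}. w (\<sigma> i) - w i)" .
    show "\<bar>sum w (\<sigma> ` S) - sum w S\<bar> = \<bar>w j - w k\<bar>"
    proof (cases "j \<in> S")
      case True
      then have "S \<inter> {j, k} = {j}" using sep by auto
      then show ?thesis using * by (simp add: \<sigma>_def)
    next
      case False
      then have "S \<inter> {j, k} = {k}" using sep by auto
      then show ?thesis using * by (simp add: \<sigma>_def)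
    qed
  qed
  have "(`) \<sigma> ` Y \<subseteq> X - Y"
  proof
    fix T assume "T \<in> (`) \<sigma> ` Y"
    then obtain S where S: "S \<in> X" "\<bar>sum w S - b\<bar> \<le> r" "T = \<sigma> ` S" by (auto simp: Y_def)
    then have "\<bar>sum w T - b\<bar> > r" using img(2)[OF S(1)] gap S(2) unfolding S(3) by linarith
    then show "T \<in> X - Y" using S img(1) by (auto simp: Y_def)
  qed
  moreover have "inj_on ((`) \<sigma>) Y" using \<sigma> by (meson inj_image_eq_iff inj_onI)
  ultimately have "card Y \<le> card (X - Y)"
    using finX by (metis card_image card_mono finite_Diff)
  moreover have "card (X - Y) = card X - card Y" "card Y \<le> card X"
    using finX by (auto simp: Y_def intro: card_Diff_subset card_mono)
  ultimately have "card X \<le> 2 * card (X - Y)" by linarith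
  with card_half_sets_separating[OF n jk \<open>j \<noteq> k\<close>] have cardXY: "card (half_sets n) \<le> 4 * card (X - Y)"
    by (simp add: X_def)
  have XY: "X - Y \<subseteq> half_sets n" by (auto simp: X_def)
  \<comment> \<open>At least half of the half-sets separate j and k, and at least half of these are
    further than r from b, where the kernel is at most 1/2. A quarter of all half-sets thus loses
    1/2 each, and 1 - 1/8 = 7/8.\<close>
  have "(\<Sum>S\<in>half_sets n. 1 / (1 + ((sum w S - b) / r)\<^sup>2)) \<le> (\<Sum>S\<in>half_sets n. if S \<in> X - Y then 1/2 else 1)"
  proof (intro sum_mono)
    fix S
    have "((sum w S - b) / r)\<^sup>2 \<ge> 1" if "S \<in> X - Y"
    proof -
      have "r \<le> \<bar>sum w S - b\<bar>" using that by (auto simp: Y_def)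
      then show ?thesis using r by (simp add: abs_le_square_iff[of 1, simplified, symmetric])
    qed
    moreover have "1 / (1 + x) \<le> 1 / 2" if "x \<ge> 1" for x :: real using that by (simp add: divide_simps)
    moreover have "1 / (1 + x) \<le> 1" if "x \<ge> 0" for x :: real using that by (simp add: divide_simps)
    ultimately show "1 / (1 + ((sum w S - b) / r)\<^sup>2) \<le> (if S \<in> X - Y then 1/2 else 1)"
      by (cases "S \<in> X - Y") (simp_all only: if_True if_False zero_le_power2)
  qed
  also have "\<dots> = (\<Sum>S\<in>half_sets n. 1 - (if S \<in> X - Y then 1/2 else 0))" by (intro sum.cong) auto
  also have "\<dots> = card (half_sets n) - card (X - Y) / 2"
  proof -
    have "half_sets n \<inter> {S. S \<in> X - Y} = X - Y" using XY by blast
    then show ?thesis by (simp add: sum_subtractf sum.If_cases del: Diff_iff)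
  qed
  also have "\<dots> \<le> 7 / 8 * card (half_sets n)" using cardXY by linarith
  finally show ?thesis
    unfolding smooth_conc_def using card_half_sets_pos[of n] by (simp add: divide_le_eq)
qed

section \<open>Vectors near the integer lattice\<close>

text \<open>The integer part of \<psi> is moved into k. A shift of size at most 1/2 is what later
  bounds |i| by 4 (i - \<psi>)^2 for integers i, and what keeps the common target of the rows within
  n.\<close>

lemma near_shift_small:
  assumes "near n K y"
  obtains \<psi> :: real and k :: "nat \<Rightarrow> int" where "\<bar>\<psi>\<bar> \<le> 1/2" "(\<Sum>j<n. (y j + \<psi> - k j)\<^sup>2) \<le> K"
proof -
  obtain \<psi> :: real and k :: "nat \<Rightarrow> int" where k: "(\<Sum>j<n. (y j + \<psi> - k j)\<^sup>2) \<le> K"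
    using assms by (auto simp: near_def)
  show ?thesis
  proof (rule that)
    show "\<bar>\<psi> - round \<psi>\<bar> \<le> 1/2" using of_int_round_abs_le[of \<psi>] by (simp add: abs_minus_commute)
    show "(\<Sum>j<n. (y j + (\<psi> - round \<psi>) - (k j - round \<psi>))\<^sup>2) \<le> K"
    proof -
      have "y j + (\<psi> - round \<psi>) - (k j - round \<psi>) = y j + \<psi> - k j" for j by simp
      then show ?thesis using k by (simp only:)
    qed
  qed
qed

lemma sum_abs_le_sqrt:
  fixes f :: "nat \<Rightarrow> real"
  assumes "(\<Sum>j<n. (f j)\<^sup>2) \<le> B"
  shows "(\<Sum>j<n. \<bar>f j\<bar>) \<le> sqrt (n * B)"
proof -
  have "(\<Sum>j<n. \<bar>f j\<bar> * 1)\<^sup>2 \<le> (\<Sum>j<n. \<bar>f j\<bar>\<^sup>2) * (\<Sum>j<n. 1\<^sup>2)" by (rule Cauchy_Schwarz_ineq_sum)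
  also have "\<dots> = n * (\<Sum>j<n. (f j)\<^sup>2)" by simp
  also have "\<dots> \<le> n * B" using assms by (intro mult_left_mono) auto
  finally show ?thesis by (intro real_le_rsqrt) simp
qed

text \<open>Since |i| \<le> 4 (i - \<psi>)^2 for integers i, the l1 norm of k is controlled by its
  squared l2 distance to the constant \<psi>, which is at most 2 \<theta>^2 + 2 K. If \<theta>^2 and
  K are small against n, then k is mostly zero, so \<theta> x + \<psi> is small in l1 and x is close
  to the constant - \<psi> / \<theta>.\<close>

lemma near_imp_close_to_constant:
  fixes x :: "nat \<Rightarrow> real"
  assumes x: "(\<Sum>j<n. (x j)\<^sup>2) = 1" and \<theta>: "\<theta> > 0" and near: "near n K (\<lambda>j. \<theta> * x j)"
  shows "\<exists>c. (\<Sum>j<n. \<bar>x j - c\<bar>) \<le> (sqrt (n * K) + 8 * \<theta>\<^sup>2 + 8 * K) / \<theta>"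
proof -
  obtain \<psi> :: real and k :: "nat \<Rightarrow> int"
    where \<psi>: "\<bar>\<psi>\<bar> \<le> 1/2" and k: "(\<Sum>j<n. (\<theta> * x j + \<psi> - k j)\<^sup>2) \<le> K"
    using near_shift_small[OF near] .
  have int: "\<bar>real_of_int i\<bar> \<le> 4 * (i - \<psi>)\<^sup>2" for i :: int
  proof (cases "i = 0")
    case False
    then have i1: "1 \<le> \<bar>real_of_int i\<bar>" by linarith
    then have "\<bar>real_of_int i\<bar> / 2 \<le> \<bar>i - \<psi>\<bar>" using \<psi> by linarith
    then have "(\<bar>real_of_int i\<bar> / 2)\<^sup>2 \<le> (i - \<psi>)\<^sup>2" by (metis abs_ge_zero divide_nonneg_nonneg power2_abs power_mono zero_le_numeral)
    then have "(real_of_int i)\<^sup>2 \<le> 4 * (i - \<psi>)\<^sup>2" by (simp add: power_divide)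
    moreover have "\<bar>real_of_int i\<bar> \<le> (real_of_int i)\<^sup>2"
      using mult_left_mono[OF i1, of "\<bar>real_of_int i\<bar>"] by (simp add: power2_eq_square flip: abs_mult)
    ultimately show ?thesis by linarith
  qed auto
  have "(\<Sum>j<n. (k j - \<psi>)\<^sup>2) \<le> (\<Sum>j<n. 2 * (\<theta> * x j)\<^sup>2 + 2 * (\<theta> * x j + \<psi> - k j)\<^sup>2)"
  proof (intro sum_mono)
    fix j
    have "0 \<le> (\<theta> * x j + (\<theta> * x j + \<psi> - k j))\<^sup>2" by simp
    then show "(k j - \<psi>)\<^sup>2 \<le> 2 * (\<theta> * x j)\<^sup>2 + 2 * (\<theta> * x j + \<psi> - k j)\<^sup>2"
      by (simp add: power2_eq_square algebra_simps)
  qed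
  also have "\<dots> = 2 * \<theta>\<^sup>2 * (\<Sum>j<n. (x j)\<^sup>2) + 2 * (\<Sum>j<n. (\<theta> * x j + \<psi> - k j)\<^sup>2)"
    by (simp add: sum.distrib sum_distrib_left power_mult_distrib mult_ac)
  also have "\<dots> \<le> 2 * \<theta>\<^sup>2 + 2 * K" using k x by simp
  finally have k2: "(\<Sum>j<n. (k j - \<psi>)\<^sup>2) \<le> 2 * \<theta>\<^sup>2 + 2 * K" .
  have "\<theta> * (\<Sum>j<n. \<bar>x j - (- \<psi> / \<theta>)\<bar>) = (\<Sum>j<n. \<bar>\<theta> * x j + \<psi>\<bar>)"
    unfolding sum_distrib_left
  proof (intro sum.cong refl)
    fix j
    have "\<theta> * \<bar>x j - (- \<psi> / \<theta>)\<bar> = \<bar>\<theta> * (x j - (- \<psi> / \<theta>))\<bar>" using \<theta> by (simp only: abs_mult)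
    also have "\<theta> * (x j - (- \<psi> / \<theta>)) = \<theta> * x j + \<psi>" using \<theta> by (simp add: field_simps)
    finally show "\<theta> * \<bar>x j - (- \<psi> / \<theta>)\<bar> = \<bar>\<theta> * x j + \<psi>\<bar>" .
  qed
  also have "\<dots> \<le> (\<Sum>j<n. \<bar>\<theta> * x j + \<psi> - k j\<bar> + 4 * (k j - \<psi>)\<^sup>2)"
  proof (intro sum_mono)
    fix j show "\<bar>\<theta> * x j + \<psi>\<bar> \<le> \<bar>\<theta> * x j + \<psi> - k j\<bar> + 4 * (k j - \<psi>)\<^sup>2"
      using int[of "k j"] by linarith
  qed
  also have "\<dots> = (\<Sum>j<n. \<bar>\<theta> * x j + \<psi> - k j\<bar>) + 4 * (\<Sum>j<n. (k j - \<psi>)\<^sup>2)"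
    by (simp add: sum.distrib sum_distrib_left)
  also have "\<dots> \<le> sqrt (n * K) + 8 * \<theta>\<^sup>2 + 8 * K"
    using sum_abs_le_sqrt[OF k] k2 by linarith
  finally show ?thesis using \<theta> by (intro exI[of _ "- \<psi> / \<theta>"]) (simp add: field_simps)
qed

text \<open>If x has l2 distance \<beta> from the constant \<alpha>, orthogonality to a half-set
  gives sqrt n |\<alpha>| \<le> sqrt 2 \<beta>. Then 1 is at most (1 + sqrt 2) \<beta>, hence at
  most (1 + 3/2) \<beta>.\<close>

lemma dist_to_constants_ge:
  fixes x :: "nat \<Rightarrow> real"
  assumes x: "(\<Sum>j<n. (x j)\<^sup>2) = 1" and S: "S \<in> half_sets n" "even n" "n > 0" and xS: "sum x S = 0"
  shows "L2_set (\<lambda>j. x j - \<alpha>) {..<n} \<ge> 2/5"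
proof -
  define \<beta> where "\<beta> = L2_set (\<lambda>j. x j - \<alpha>) {..<n}"
  have \<beta>2: "\<beta>\<^sup>2 = (\<Sum>j<n. (x j - \<alpha>)\<^sup>2)" by (simp add: \<beta>_def L2_set_def sum_nonneg)
  have cS: "real (card S) = n / 2" and Ss: "S \<subseteq> {..<n}" and fS: "finite S"
    using S card_half_set[OF S(1)] half_sets_subset[OF S(1)] by (auto intro: finite_subset elim!: evenE)
  have "(\<Sum>j\<in>S. (x j - \<alpha>) * 1)\<^sup>2 \<le> (\<Sum>j\<in>S. (x j - \<alpha>)\<^sup>2) * (\<Sum>j\<in>S. 1\<^sup>2)" by (rule Cauchy_Schwarz_ineq_sum)
  also have "(\<Sum>j\<in>S. (x j - \<alpha>) * 1) = - (n / 2 * \<alpha>)" using xS cS by (simp add: sum_subtractf)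
  also have "(\<Sum>j\<in>S. (x j - \<alpha>)\<^sup>2) * (\<Sum>j\<in>S. 1\<^sup>2) \<le> \<beta>\<^sup>2 * (n / 2)"
    unfolding \<beta>2 using Ss cS by (intro mult_mono sum_mono2) (auto intro: sum_nonneg)
  finally have "n / 2 * (n * \<alpha>\<^sup>2) \<le> n / 2 * (2 * \<beta>\<^sup>2)" by (simp add: power_mult_distrib power2_eq_square mult_ac)
  then have "n * \<alpha>\<^sup>2 \<le> 2 * \<beta>\<^sup>2" using S(3) by (subst (asm) mult_le_cancel_left_pos) auto
  then have "sqrt (n * \<alpha>\<^sup>2) \<le> sqrt (2 * \<beta>\<^sup>2)" by simp
  then have "sqrt n * \<bar>\<alpha>\<bar> \<le> sqrt 2 * \<beta>"
    by (simp add: real_sqrt_mult \<beta>_def)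
  moreover have "sqrt 2 \<le> 3/2" by (intro real_le_lsqrt) (auto simp: power2_eq_square)
  then have "sqrt 2 * \<beta> \<le> 3/2 * \<beta>" by (intro mult_right_mono) (auto simp: \<beta>_def)
  moreover have "L2_set x {..<n} \<le> L2_set (\<lambda>j. x j - \<alpha>) {..<n} + L2_set (\<lambda>j. \<alpha>) {..<n}"
    using L2_set_triangle_ineq[of "\<lambda>j. x j - \<alpha>" "\<lambda>j. \<alpha>" "{..<n}"] by simp
  moreover have "L2_set x {..<n} = 1" using x by (simp add: L2_set_def)
  ultimately show ?thesis by (simp add: \<beta>_def L2_set_constant)
qed

text \<open>The common sum b0 need not be an integer. Taking its floor costs at most 1 per row and
  makes the targets countable along with w; the cut to \<open>extensional\<close> makes distinct w
  differ on the first n coordinates.\<close>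

lemma round_on_half_sets:
  fixes y :: "nat \<Rightarrow> real" and k :: "nat \<Rightarrow> int" and G :: "'i \<Rightarrow> nat set"
  assumes I: "finite I" "card I \<le> n" and G: "G \<in> I \<rightarrow>\<^sub>E half_sets n" and b0: "\<And>i. i \<in> I \<Longrightarrow> sum y (G i) = b0"
    and V: "(\<Sum>j<n. \<bar>y j - k j\<bar>) \<le> V"
  shows "\<exists>w\<in>extensional {..<n}. (\<Sum>i\<in>I. ((\<Sum>j\<in>G i. real_of_int (w j)) - \<lfloor>b0\<rfloor>)\<^sup>2) \<le> 4 * real n * V + 2 * real n
     \<and> L2_set (\<lambda>j. w j - y j) {..<n} \<le> sqrt (2 * V)"
proof -
  have Gs: "G i \<subseteq> {..<n}" if "i \<in> I" for i using G that by (auto simp: half_sets_def PiE_iff)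
  obtain m :: "nat \<Rightarrow> int" where m: "(\<Sum>i\<in>I. (\<Sum>j\<in>G i. m j - y j)\<^sup>2) \<le> 2 * real n * V" "(\<Sum>j<n. (m j - y j)\<^sup>2) \<le> 2 * V"
    using round_sets[where S = G, OF I Gs V] by blast
  define w where "w = restrict m {..<n}"
  have "(\<Sum>i\<in>I. ((\<Sum>j\<in>G i. real_of_int (w j)) - \<lfloor>b0\<rfloor>)\<^sup>2) \<le> (\<Sum>i\<in>I. 2 * (\<Sum>j\<in>G i. m j - y j)\<^sup>2 + 2)"
  proof (intro sum_mono)
    fix i assume i: "i \<in> I"
    have "(\<Sum>j\<in>G i. real_of_int (w j)) = (\<Sum>j\<in>G i. real_of_int (m j))"
      using Gs[OF i] by (intro sum.cong) (auto simp: w_def)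
    then have a: "(\<Sum>j\<in>G i. real_of_int (w j)) - \<lfloor>b0\<rfloor> = (\<Sum>j\<in>G i. m j - y j) + (b0 - \<lfloor>b0\<rfloor>)"
      using b0[OF i] by (simp add: sum_subtractf)
    have "\<bar>b0 - \<lfloor>b0\<rfloor>\<bar> \<le> 1" by linarith
    then have "(b0 - \<lfloor>b0\<rfloor>)\<^sup>2 \<le> 1" by (simp add: abs_square_le_1)
    moreover have "(p + q)\<^sup>2 \<le> 2 * p\<^sup>2 + 2 * q\<^sup>2" for p q :: real
      using zero_le_power2[of "p - q"] by (simp add: power2_sum power2_diff)
    ultimately show "((\<Sum>j\<in>G i. real_of_int (w j)) - \<lfloor>b0\<rfloor>)\<^sup>2 \<le> 2 * (\<Sum>j\<in>G i. m j - y j)\<^sup>2 + 2"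
      unfolding a by (smt (verit))
  qed
  also have "\<dots> = 2 * (\<Sum>i\<in>I. (\<Sum>j\<in>G i. m j - y j)\<^sup>2) + 2 * card I"
    by (simp add: sum.distrib sum_distrib_left)
  also have "\<dots> \<le> 4 * real n * V + 2 * real n" using m(1) I(2) by linarith
  finally have "(\<Sum>i\<in>I. ((\<Sum>j\<in>G i. real_of_int (w j)) - \<lfloor>b0\<rfloor>)\<^sup>2) \<le> 4 * real n * V + 2 * real n" .
  moreover have "L2_set (\<lambda>j. w j - y j) {..<n} = L2_set (\<lambda>j. m j - y j) {..<n}"
    by (intro L2_set_cong) (auto simp: w_def)
  moreover have "L2_set (\<lambda>j. m j - y j) {..<n} \<le> sqrt (2 * V)" using m(2) by (simp add: L2_set_def)
  moreover have "w \<in> extensional {..<n}" by (simp add: w_def)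
  ultimately show ?thesis by (intro bexI[of _ w]) auto
qed

text \<open>If two coordinates differ by more than 2 r, exchanging them suffices. Otherwise v times
  any difference is at most 1/2 at all frequencies in use, so being near the lattice cannot be an
  effect of wrapping around and would force w close to a constant.\<close>

lemma smooth_conc_le_of_spread:
  fixes w :: "nat \<Rightarrow> real"
  assumes n: "even n" "n > 0" and r: "r > 0" and K: "K > 0" and l: "l > 0"
    and spread: "\<And>c. L2_set (\<lambda>j. w j - c) {..<n} \<ge> l"
    and small: "6 * pi * r * sqrt K / l + n * exp (-K) \<le> 1/4"
  shows "smooth_conc n r w b \<le> 7 / 8"
proof (cases "\<exists>j<n. \<exists>k<n. \<bar>w j - w k\<bar> > 2 * r")
  case True
  then show ?thesis using smooth_conc_le_of_gap[OF n(1)] r by blast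
next
  case False
  then have gap: "\<bar>w j - w k\<bar> \<le> 2 * r" if "j < n" "k < n" for j k using False that by (meson not_less)
  \<comment> \<open>The cut-off 3/2 balances two demands: v * 2 r \<le> 3 / (2 pi) \<le> 1/2 on the
    whole range, and a truncation error 2 exp (- 3/2) \<le> 3/5, where 1/4 + 3/5 < 7/8.\<close>
  have "smooth_conc n r w b \<le> 2 * pi * r * (3 * sqrt K / l) + n * exp (-K) + 2 * exp (- (3/2))"
  proof (rule smooth_conc_le)
    fix v assume v: "3 * sqrt K / l \<le> v" "v \<le> 3 / 2 / (2 * pi * r)"
    have "3 * sqrt K / l > 0" using K l by simp
    then have v0: "v > 0" using v(1) by linarith
    have "v * (2 * r) \<le> 3 / 2 / (2 * pi * r) * (2 * r)" using v r by (intro mult_right_mono) auto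
    also have "\<dots> = 3 / (2 * pi)" using r by (simp add: field_simps)
    also have "\<dots> \<le> 1/2" using pi_gt3 by (simp add: field_simps)
    finally have vr: "v * (2 * r) \<le> 1/2" .
    show "\<not> near n K (\<lambda>j. v * w j)"
    proof
      assume "near n K (\<lambda>j. v * w j)"
      then obtain \<psi> :: real and m :: "nat \<Rightarrow> int" where m: "(\<Sum>j<n. (v * w j + \<psi> - m j)\<^sup>2) \<le> K"
        by (auto simp: near_def)
      define e where "e j = v * w j + \<psi> - m j" for j
      \<comment> \<open>The coordinate of least error is the reference, so its error can be replaced
        by that of j. The sum of squared differences is then at most 4 K, against the 9 K that the
        spread of w requires.\<close>
      obtain k where k: "k < n" "\<And>j. j < n \<Longrightarrow> (e k)\<^sup>2 \<le> (e j)\<^sup>2"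
      proof -
        have "finite ((\<lambda>j. (e j)\<^sup>2) ` {..<n})" "(\<lambda>j. (e j)\<^sup>2) ` {..<n} \<noteq> {}" using n by auto
        from Min_in[OF this] Min_le[OF this(1)] that show ?thesis by (smt (verit) image_iff imageI lessThan_iff)
      qed
      have le: "v\<^sup>2 * (w j - w k)\<^sup>2 \<le> 2 * (e j)\<^sup>2 + 2 * (e k)\<^sup>2" if j: "j < n" for j
      proof -
        have small: "\<bar>v * (w j - w k)\<bar> \<le> 1/2"
        proof -
          have "\<bar>v * (w j - w k)\<bar> \<le> v * (2 * r)"
            using gap[OF j k(1)] v0 by (simp add: abs_mult mult_left_mono)
          then show ?thesis using vr by linarith
        qed
        \<comment> \<open>If the nearby integers differ, the errors differ by at least 1 - 1/2,
          which is still no less than the left side.\<close>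
        have "\<bar>v * (w j - w k)\<bar> \<le> \<bar>e j - e k\<bar>"
        proof (cases "m j = m k")
          case True then show ?thesis by (simp add: e_def algebra_simps)
        next
          case False
          then have "1 \<le> \<bar>real_of_int (m j) - m k\<bar>" by linarith
          moreover have "v * (w j - w k) = (e j - e k) + (real_of_int (m j) - m k)" by (simp add: e_def algebra_simps)
          ultimately show ?thesis using small by linarith
        qed
        then have "(v * (w j - w k))\<^sup>2 \<le> (e j - e k)\<^sup>2" by (simp add: abs_le_square_iff)
        also have "\<dots> \<le> 2 * (e j)\<^sup>2 + 2 * (e k)\<^sup>2"
          using zero_le_power2[of "e j + e k"] by (simp add: power2_sum power2_diff)
        finally show ?thesis by (simp add: power_mult_distrib)
      qed
      have "v\<^sup>2 * (\<Sum>j<n. (w j - w k)\<^sup>2) \<le> (\<Sum>j<n. 2 * (e j)\<^sup>2 + 2 * (e j)\<^sup>2)"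
        unfolding sum_distrib_left
      proof (intro sum_mono)
        fix j assume "j \<in> {..<n}"
        then show "v\<^sup>2 * (w j - w k)\<^sup>2 \<le> 2 * (e j)\<^sup>2 + 2 * (e j)\<^sup>2" using le[of j] k(2)[of j] by simp
      qed
      also have "\<dots> = 4 * (\<Sum>j<n. (e j)\<^sup>2)" by (simp add: sum_distrib_left)
      also have "\<dots> \<le> 4 * K" using m by (simp add: e_def)
      finally have "(v * L2_set (\<lambda>j. w j - w k) {..<n})\<^sup>2 \<le> (2 * sqrt K)\<^sup>2"
        using K by (simp add: L2_set_def power_mult_distrib sum_nonneg)
      then have "v * L2_set (\<lambda>j. w j - w k) {..<n} \<le> 2 * sqrt K"
        by (rule power2_le_imp_le) (use K in simp)
      moreover have "v * l \<le> v * L2_set (\<lambda>j. w j - w k) {..<n}" using spread v0 by (intro mult_left_mono) auto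
      moreover have "3 * sqrt K \<le> v * l" using v(1) l by (simp add: pos_divide_le_eq)
      moreover have "sqrt K > 0" using K by simp
      ultimately show False by linarith
    qed
  qed (use n r K l in auto)
  also have "2 * exp (- (3/2)) \<le> (3/5 :: real)"
  proof -
    have "(3/2) ^ 3 \<le> exp (1/2 :: real) ^ 3" using exp_ge_add_one_self[of "1/2::real"] by (intro power_mono) auto
    also have "exp (1/2 :: real) ^ 3 = exp (3/2)" by (simp flip: exp_of_nat_mult)
    finally have "10/3 \<le> exp (3/2 :: real)" by (simp add: power3_eq_cube)
    then show ?thesis by (simp add: exp_minus field_simps)
  qed
  finally show ?thesis using small by (simp add: mult_ac)
qed

section \<open>Normals close to a constant vector\<close>

text \<open>A vector of the ball of radius m + 1 lies in the ball of radius m or arises from it by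
  one of 2 n unit steps. The count is exp (O (m log n)), which is subexponential in n when m is
  below n by a power of n.\<close>

lemma finite_card_int_l1_ball:
  fixes n m :: nat
  defines "W \<equiv> \<lambda>m. {w \<in> extensional {..<n} :: (nat \<Rightarrow> int) set. (\<Sum>j<n. \<bar>w j\<bar>) \<le> int m}"
  shows "finite (W m) \<and> card (W m) \<le> (2 * n + 1) ^ m"
proof (induction m)
  case 0
  have "W 0 \<subseteq> {restrict (\<lambda>_. 0) {..<n}}"
  proof
    fix w assume w: "w \<in> W 0"
    then have "(\<Sum>j<n. \<bar>w j\<bar>) = 0" by (auto simp: W_def intro!: antisym sum_nonneg)
    then have "\<forall>j\<in>{..<n}. w j = 0" by (subst (asm) sum_nonneg_eq_0_iff) auto
    then have "w = restrict (\<lambda>_. 0) {..<n}"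
      using w by (intro extensionalityI[of _ "{..<n}"]) (auto simp: W_def)
    then show "w \<in> {restrict (\<lambda>_. 0) {..<n}}" by simp
  qed
  then show ?case using finite_subset card_mono[of "{restrict (\<lambda>_. 0) {..<n}}" "W 0"] by auto
next
  case (Suc m)
  define f where "f = (\<lambda>(w :: nat \<Rightarrow> int, j, s). w(j := w j + s))"
  let ?P = "W m \<times> {..<n} \<times> {1, -1::int}"
  have "W (Suc m) \<subseteq> W m \<union> f ` ?P"
  proof
    fix w assume w: "w \<in> W (Suc m)"
    show "w \<in> W m \<union> f ` ?P"
    proof (cases "\<exists>j<n. w j \<noteq> 0")
      case False
      then have "w \<in> W m" using w by (auto simp: W_def)
      then show ?thesis by simp
    next
      case True
      then obtain j where j: "j < n" "w j \<noteq> 0" by blast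
      define s where "s = sgn (w j)"
      define w' where "w' = w(j := w j - s)"
      have s: "s \<in> {1, -1}" "\<bar>w j - s\<bar> = \<bar>w j\<bar> - 1" using j(2) by (auto simp: s_def sgn_if)
      have "(\<Sum>i<n. \<bar>w i\<bar>) = \<bar>w j\<bar> + (\<Sum>i\<in>{..<n}-{j}. \<bar>w i\<bar>)" using j(1) by (intro sum.remove) auto
      moreover have "(\<Sum>i<n. \<bar>w' i\<bar>) = \<bar>w' j\<bar> + (\<Sum>i\<in>{..<n}-{j}. \<bar>w' i\<bar>)" using j(1) by (intro sum.remove) auto
      moreover have "(\<Sum>i\<in>{..<n}-{j}. \<bar>w' i\<bar>) = (\<Sum>i\<in>{..<n}-{j}. \<bar>w i\<bar>)" by (intro sum.cong) (auto simp: w'_def)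
      ultimately have "(\<Sum>i<n. \<bar>w' i\<bar>) = (\<Sum>i<n. \<bar>w i\<bar>) - 1" using s(2) by (simp add: w'_def)
      moreover have "w' \<in> extensional {..<n}" using w j(1) by (auto simp: W_def w'_def extensional_def)
      ultimately have "w' \<in> W m" using w by (simp add: W_def)
      moreover have "w = f (w', j, s)" by (simp add: f_def w'_def)
      ultimately show ?thesis using j(1) s(1) by blast
    qed
  qed
  moreover have "finite (W m \<union> f ` ?P)" using Suc by simp
  ultimately have fin: "finite (W (Suc m))" and "card (W (Suc m)) \<le> card (W m \<union> f ` ?P)"
    by (auto intro: finite_subset card_mono)
  note this(2)
  also have "card (W m \<union> f ` ?P) \<le> card (W m) + card (f ` ?P)" by (rule card_Un_le)
  also have "card (f ` ?P) \<le> card ?P" using Suc by (intro card_image_le) auto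
  also have "card ?P = card (W m) * (n * 2)" by (simp add: card_cartesian_product)
  also have "card (W m) + card (W m) * (n * 2) = (2 * n + 1) * card (W m)" by simp
  also have "\<dots> \<le> (2 * n + 1) * (2 * n + 1) ^ m" using Suc by (intro mult_left_mono) auto
  finally show ?case using fin by simp
qed

definition flat_kernel :: "nat \<Rightarrow> 'i set \<Rightarrow> real \<Rightarrow> ('i \<Rightarrow> nat set) set" where
  "flat_kernel n I d = {G \<in> I \<rightarrow>\<^sub>E half_sets n. \<exists>(x::nat \<Rightarrow> real) c.
     (\<Sum>j<n. (x j)\<^sup>2) = 1 \<and> (\<Sum>j<n. \<bar>x j - c\<bar>) \<le> d \<and> (\<forall>i\<in>I. sum x (G i) = 0)}"

text \<open>The rounded vector is y = L (x - c), at l1 distance at most L d from the lattice point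
  0. Integers satisfy |w j| \<le> (w j)^2, so the l1 norm of w is of order L d + L^2, far below n if
  L is far below sqrt n. The distance of x from constants keeps w spread out at scale L.\<close>

lemma flat_kernel_cover:
  fixes G :: "'i \<Rightarrow> nat set" and L d :: real
  assumes n: "even n" "n > 0" and I: "finite I" "card I \<le> n" "I \<noteq> {}"
    and L: "L > 0" and d: "0 < d" "d \<le> sqrt n" and G: "G \<in> flat_kernel n I d"
  shows "\<exists>w\<in>extensional {..<n} :: (nat \<Rightarrow> int) set. \<exists>b::int.
     (\<Sum>i\<in>I. ((\<Sum>j\<in>G i. real_of_int (w j)) - b)\<^sup>2) \<le> 4 * real n * (L * d) + 2 * real n
     \<and> \<bar>real_of_int b\<bar> \<le> L * sqrt n + 1
     \<and> (\<Sum>j<n. \<bar>real_of_int (w j)\<bar>) \<le> 4 * (L * d) + 20 * L\<^sup>2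
     \<and> (\<forall>c'::real. L2_set (\<lambda>j. real_of_int (w j) - c') {..<n} \<ge> 2 / 5 * L - sqrt (2 * (L * d)))"
proof -
  obtain x :: "nat \<Rightarrow> real" and c where x1: "(\<Sum>j<n. (x j)\<^sup>2) = 1" and xd: "(\<Sum>j<n. \<bar>x j - c\<bar>) \<le> d"
    and xG: "\<And>i. i \<in> I \<Longrightarrow> sum x (G i) = 0" and GP: "G \<in> I \<rightarrow>\<^sub>E half_sets n"
    using G by (auto simp: flat_kernel_def)
  define y where "y j = L * (x j - c)" for j
  have cG: "real (card (G i)) = n / 2" if "i \<in> I" for i
  proof -
    have "G i \<in> half_sets n" using GP that by auto
    then show ?thesis using n(1) card_half_set by (auto elim!: evenE)
  qed
  have yG: "sum y (G i) = - (L * c * (n / 2))" if "i \<in> I" for i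
    unfolding y_def sum_distrib_left[symmetric] sum_subtractf using xG[OF that] cG[OF that] by simp
  have yV: "(\<Sum>j<n. \<bar>y j - real_of_int 0\<bar>) \<le> L * d"
    using xd L by (simp add: y_def abs_mult sum_distrib_left[symmetric])
  define b where "b = \<lfloor>- (L * c * (n / 2))\<rfloor>"
  obtain w where w: "w \<in> extensional {..<n}"
     "(\<Sum>i\<in>I. ((\<Sum>j\<in>G i. real_of_int (w j)) - b)\<^sup>2) \<le> 4 * real n * (L * d) + 2 * real n"
     "L2_set (\<lambda>j. w j - y j) {..<n} \<le> sqrt (2 * (L * d))"
    using round_on_half_sets[OF I(1,2) GP yG yV] unfolding b_def by blast
  \<comment> \<open>As x is a unit vector, |c| is at most 2 / sqrt n. This bounds the target b, and
    the squared norm of x - c by 2 + 2 * 4 = 10.\<close>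
  have "n * \<bar>c\<bar> \<le> (\<Sum>j<n. \<bar>x j\<bar> + \<bar>x j - c\<bar>)"
  proof -
    have "(\<Sum>j<n. \<bar>c\<bar>) \<le> (\<Sum>j<n. \<bar>x j\<bar> + \<bar>x j - c\<bar>)" by (intro sum_mono) linarith
    then show ?thesis by simp
  qed
  also have "\<dots> \<le> sqrt n + d" using sum_abs_le_sqrt[of x n 1] x1 xd by (simp add: sum.distrib)
  finally have nc: "n * \<bar>c\<bar> \<le> 2 * sqrt n" using d by linarith
  have "\<bar>L * c * (n / 2)\<bar> = L / 2 * (n * \<bar>c\<bar>)" using L by (simp add: abs_mult)
  also have "\<dots> \<le> L / 2 * (2 * sqrt n)" using nc L by (intro mult_left_mono) auto
  finally have "\<bar>real_of_int b\<bar> \<le> L * sqrt n + 1" unfolding b_def by linarith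
  moreover have "(\<Sum>j<n. \<bar>real_of_int (w j)\<bar>) \<le> 4 * (L * d) + 20 * L\<^sup>2"
  proof -
    have "n * (n * c\<^sup>2) = (n * \<bar>c\<bar>)\<^sup>2" by (simp add: power_mult_distrib) (simp add: power2_eq_square)
    also have "\<dots> \<le> (2 * sqrt n)\<^sup>2" using nc by (intro power_mono) auto
    also have "\<dots> = real n * 4" by (simp add: power_mult_distrib)
    finally have "n * (n * c\<^sup>2) \<le> real n * 4" .
    then have nc2: "n * c\<^sup>2 \<le> 4" using n(2) by (subst (asm) mult_le_cancel_left_pos) auto
    have sq: "(p - q)\<^sup>2 \<le> 2 * p\<^sup>2 + 2 * q\<^sup>2" for p q :: real
      using zero_le_power2[of "p + q"] by (simp add: power2_sum power2_diff)
    have "(\<Sum>j<n. (x j - c)\<^sup>2) \<le> (\<Sum>j<n. 2 * (x j)\<^sup>2 + 2 * c\<^sup>2)" by (intro sum_mono sq)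
    also have "\<dots> \<le> 10" using x1 nc2 by (simp add: sum.distrib sum_distrib_left[symmetric])
    finally have xc: "(\<Sum>j<n. (x j - c)\<^sup>2) \<le> 10" .
    have "(L2_set (\<lambda>j. w j - y j) {..<n})\<^sup>2 \<le> (sqrt (2 * (L * d)))\<^sup>2" using w(3) by (intro power_mono) auto
    then have wy: "(\<Sum>j<n. (w j - y j)\<^sup>2) \<le> 2 * (L * d)" using L d by (simp add: L2_set_def sum_nonneg)
    have "(\<Sum>j<n. \<bar>real_of_int (w j)\<bar>) \<le> (\<Sum>j<n. 2 * (w j - y j)\<^sup>2 + 2 * (y j)\<^sup>2)"
    proof (intro sum_mono)
      fix j
      have "\<bar>w j\<bar> \<le> (w j)\<^sup>2"
      proof (cases "w j = 0")
        case False
        then have "\<bar>w j\<bar> * 1 \<le> \<bar>w j\<bar> * \<bar>w j\<bar>" by (intro mult_left_mono) auto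
        then show ?thesis by (simp add: power2_eq_square)
      qed auto
      then have "real_of_int \<bar>w j\<bar> \<le> real_of_int ((w j)\<^sup>2)" by (simp only: of_int_le_iff)
      then have "\<bar>real_of_int (w j)\<bar> \<le> (real_of_int (w j))\<^sup>2" by simp
      also have "\<dots> \<le> 2 * (w j - y j)\<^sup>2 + 2 * (y j)\<^sup>2"
        using sq[of "w j - y j" "- y j"] by simp
      finally show "\<bar>real_of_int (w j)\<bar> \<le> 2 * (w j - y j)\<^sup>2 + 2 * (y j)\<^sup>2" .
    qed
    also have "\<dots> = 2 * (\<Sum>j<n. (w j - y j)\<^sup>2) + 2 * (L\<^sup>2 * (\<Sum>j<n. (x j - c)\<^sup>2))"
      by (simp add: sum.distrib sum_distrib_left y_def power_mult_distrib mult_ac)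
    also have "\<dots> \<le> 2 * (2 * (L * d)) + 2 * (L\<^sup>2 * 10)"
      using wy xc by (intro add_mono mult_left_mono) auto
    finally show ?thesis by simp
  qed
  moreover have "L2_set (\<lambda>j. real_of_int (w j) - c') {..<n} \<ge> 2 / 5 * L - sqrt (2 * (L * d))" for c' :: real
  proof -
    obtain i where i: "i \<in> I" using I(3) by blast
    have "G i \<in> half_sets n" using GP i by auto
    from dist_to_constants_ge[OF x1 this n xG[OF i]]
    have "L * (2/5) \<le> L * L2_set (\<lambda>j. x j - (c + c' / L)) {..<n}" using L by (intro mult_left_mono) auto
    also have "\<dots> = L2_set (\<lambda>j. L * (x j - (c + c' / L))) {..<n}"
      using L by (intro L2_set_right_distrib) auto
    also have "\<dots> = L2_set (\<lambda>j. (w j - c') + (y j - w j)) {..<n}"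
      using L by (intro L2_set_cong) (auto simp: y_def field_simps)
    also have "\<dots> \<le> L2_set (\<lambda>j. w j - c') {..<n} + L2_set (\<lambda>j. y j - w j) {..<n}"
      by (rule L2_set_triangle_ineq)
    also have "L2_set (\<lambda>j. y j - w j) {..<n} = L2_set (\<lambda>j. w j - y j) {..<n}"
      unfolding L2_set_def by (simp add: power2_commute)
    finally show ?thesis using w(3) by simp
  qed
  ultimately show ?thesis using w(1,2) by blast
qed

text \<open>A union bound over the pairs (w, b). Their number will be exp (o (n)), so a probability
  of 7/8 per row is enough, provided that the tensorization loss is exp (o (n)) too.\<close>

lemma card_flat_kernel_le:
  fixes I :: "'i set" and m p :: nat and L d r K l :: real
  assumes n: "even n" "n > 0" and I: "finite I" "card I \<le> n" "I \<noteq> {}"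
    and L: "L > 0" and d: "0 < d" "d \<le> sqrt n" and r: "r > 0" and K: "K > 0"
    and l: "l > 0" "l \<le> 2 / 5 * L - sqrt (2 * (L * d))"
    and small: "6 * pi * r * sqrt K / l + n * exp (-K) \<le> 1/4"
    and m: "4 * (L * d) + 20 * L\<^sup>2 \<le> m" and p: "L * sqrt n + 1 \<le> p"
  shows "card (flat_kernel n I d) \<le> (2 * real n + 1) ^ m * (2 * real p + 1)
     * (exp ((4 * real n * (L * d) + 2 * real n) / r\<^sup>2) * (7/8 * card (half_sets n)) ^ card I)"
proof -
  define M where "M = 4 * real n * (L * d) + 2 * real n"
  define W where "W = {w \<in> extensional {..<n} :: (nat \<Rightarrow> int) set. (\<Sum>j<n. \<bar>w j\<bar>) \<le> int m}"
  define W' where "W' = {w \<in> W. \<forall>b. smooth_conc n r (\<lambda>j. real_of_int (w j)) b \<le> 7/8}"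
  define T where "T = (\<lambda>(w, b::int). {G \<in> I \<rightarrow>\<^sub>E half_sets n. (\<Sum>i\<in>I. (sum (\<lambda>j. real_of_int (w j)) (G i) - b)\<^sup>2) \<le> M})"
  let ?B = "exp (M / r\<^sup>2) * (7/8 * card (half_sets n)) ^ card I"
  have W: "finite W" "card W \<le> (2 * n + 1) ^ m"
    using finite_card_int_l1_ball[of n m] by (simp_all add: W_def)
  have finW': "finite W'" using W by (simp add: W'_def)
  have "flat_kernel n I d \<subseteq> (\<Union>z\<in>W' \<times> {- int p..int p}. T z)"
  proof
    fix G assume G: "G \<in> flat_kernel n I d"
    then have GP: "G \<in> I \<rightarrow>\<^sub>E half_sets n" by (simp add: flat_kernel_def)
    obtain w :: "nat \<Rightarrow> int" and b :: int where w: "w \<in> extensional {..<n}"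
      "(\<Sum>i\<in>I. ((\<Sum>j\<in>G i. real_of_int (w j)) - b)\<^sup>2) \<le> M"
      and b: "\<bar>real_of_int b\<bar> \<le> L * sqrt n + 1"
      and wm: "(\<Sum>j<n. \<bar>real_of_int (w j)\<bar>) \<le> 4 * (L * d) + 20 * L\<^sup>2"
      and spread: "\<And>c'::real. L2_set (\<lambda>j. real_of_int (w j) - c') {..<n} \<ge> 2 / 5 * L - sqrt (2 * (L * d))"
      using flat_kernel_cover[OF n I L d G] unfolding M_def by blast
    have "real_of_int (\<Sum>j<n. \<bar>w j\<bar>) \<le> real_of_int (int m)" using wm m by simp
    then have "w \<in> W" using w(1) by (simp only: of_int_le_iff) (simp add: W_def)
    moreover have "smooth_conc n r (\<lambda>j. real_of_int (w j)) b' \<le> 7/8" for b'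
    proof (rule smooth_conc_le_of_spread[OF n r K l(1) _ small])
      show "l \<le> L2_set (\<lambda>j. real_of_int (w j) - c) {..<n}" for c :: real using spread[of c] l(2) by linarith
    qed
    moreover have "b \<in> {- int p..int p}"
    proof -
      have "\<bar>real_of_int b\<bar> \<le> real_of_int (int p)" using b p by simp
      then have "real_of_int \<bar>b\<bar> \<le> real_of_int (int p)" by simp
      then have "\<bar>b\<bar> \<le> int p" by (simp only: of_int_le_iff)
      then show ?thesis by auto
    qed
    ultimately show "G \<in> (\<Union>z\<in>W' \<times> {- int p..int p}. T z)"
      using GP w(2) by (intro UN_I[of "(w, b)"]) (auto simp: W'_def T_def)
  qed
  moreover have finT: "finite (T z)" for z
  proof (rule finite_subset)
    show "T z \<subseteq> I \<rightarrow>\<^sub>E half_sets n" by (auto simp: T_def split: prod.splits)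
    show "finite (I \<rightarrow>\<^sub>E half_sets n)" using I(1) by (intro finite_PiE) auto
  qed
  ultimately have "card (flat_kernel n I d) \<le> card (\<Union>z\<in>W' \<times> {- int p..int p}. T z)"
    using finW' by (intro card_mono) auto
  also have "\<dots> \<le> (\<Sum>z\<in>W' \<times> {- int p..int p}. card (T z))" using finW' by (intro card_UN_le) auto
  finally have "real (card (flat_kernel n I d)) \<le> (\<Sum>z\<in>W' \<times> {- int p..int p}. real (card (T z)))"
    by (metis of_nat_le_iff of_nat_sum)
  also have "\<dots> \<le> (\<Sum>z\<in>W' \<times> {- int p..int p}. ?B)"
  proof (intro sum_mono)
    fix z assume "z \<in> W' \<times> {- int p..int p}"
    then obtain w b where z: "z = (w, b)" "w \<in> W'" by auto
    have "card (T z) \<le> exp (M / r\<^sup>2) * (smooth_conc n r (\<lambda>j. real_of_int (w j)) b * card (half_sets n)) ^ card I"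
      unfolding z T_def prod.case by (rule tensorize[OF I(1) r])
    also have "\<dots> \<le> ?B"
      using z(2) by (intro mult_left_mono power_mono mult_right_mono mult_nonneg_nonneg smooth_conc_nonneg) (auto simp: W'_def)
    finally show "real (card (T z)) \<le> ?B" .
  qed
  also have "\<dots> = card W' * (2 * real p + 1) * ?B" by (simp add: card_cartesian_product)
  also have "\<dots> \<le> (2 * real n + 1) ^ m * (2 * real p + 1) * ?B"
  proof (intro mult_right_mono)
    have "card W' \<le> card W" using W(1) by (intro card_mono) (auto simp: W'_def)
    then have "card W' \<le> (2 * n + 1) ^ m" using W(2) by linarith
    then have "real (card W') \<le> real ((2 * n + 1) ^ m)" by (simp only: of_nat_le_iff)
    then show "real (card W') \<le> (2 * real n + 1) ^ m" by (simp add: add.commute)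
  qed auto
  finally show ?thesis by (simp add: M_def)
qed

section \<open>Arithmetically structured normals\<close>

text \<open>The factor 2 leaves room for choosing \<theta> below twice the infimum of the admissible
  values. The excluded range is then reached by the multiples v \<theta> with v < 1/2.\<close>

definition structured_kernel :: "nat \<Rightarrow> 'i set \<Rightarrow> real \<Rightarrow> real \<Rightarrow> real \<Rightarrow> real \<Rightarrow> ('i \<Rightarrow> nat set) set" where
  "structured_kernel n I K \<theta>0 \<theta>1 D = {G \<in> I \<rightarrow>\<^sub>E half_sets n. \<exists>(x::nat \<Rightarrow> real) \<theta>.
     (\<Sum>j<n. (x j)\<^sup>2) = 1 \<and> (\<forall>i\<in>I. sum x (G i) = 0) \<and> \<theta>1 \<le> \<theta> \<and> \<theta> \<le> D \<and> near n K (\<lambda>j. \<theta> * x j)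
     \<and> (\<forall>\<theta>'. \<theta>0 \<le> \<theta>' \<longrightarrow> \<theta>' < \<theta> / 2 \<longrightarrow> \<not> near n K (\<lambda>j. \<theta>' * x j))}"

lemma near_of_L2_set:
  assumes "L2_set (\<lambda>j. y j + \<psi> - real_of_int (k j)) {..<n} \<le> sqrt K" "K \<ge> 0"
  shows "near n K y"
proof -
  have "(L2_set (\<lambda>j. y j + \<psi> - real_of_int (k j)) {..<n})\<^sup>2 \<le> (sqrt K)\<^sup>2" using assms by (intro power_mono) auto
  then show ?thesis using assms(2) unfolding near_def by (auto simp: L2_set_def sum_nonneg)
qed

text \<open>Minimality passes from x to w: if v w is within sqrt K / 2 of the shifted lattice, and v
  times the rounding error is at most sqrt K / 2, then v \<theta> x is within sqrt K, which is
  excluded. Hence the radius \<open>K / 4\<close>.\<close>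

lemma structured_kernel_cover:
  fixes G :: "'i \<Rightarrow> nat set"
  assumes n: "even n" "n > 0" and I: "finite I" "card I \<le> n"
    and K: "K > 0" and V: "V = sqrt (n * K)" and \<theta>1: "\<theta>1 > 0"
    and G: "G \<in> structured_kernel n I K \<theta>0 \<theta>1 D"
  obtains w :: "nat \<Rightarrow> int" and b :: int and \<theta> :: real
  where "w \<in> extensional {..<n}"
    and "(\<Sum>i\<in>I. ((\<Sum>j\<in>G i. real_of_int (w j)) - b)\<^sup>2) \<le> 4 * real n * V + 2 * real n"
    and "\<bar>b\<bar> \<le> int n" and "\<theta>1 \<le> \<theta>" and "\<theta> \<le> D"
    and "L2_set w {..<n} \<le> \<theta> + sqrt n / 2 + sqrt (2 * V)"
    and "\<And>v::real. \<theta>0 / \<theta> \<le> v \<Longrightarrow> 0 < v \<Longrightarrow> v < 1/2 \<Longrightarrow> v * sqrt (2 * V) \<le> sqrt K / 2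
      \<Longrightarrow> \<not> near n (K / 4) (\<lambda>j. v * real_of_int (w j))"
proof -
  obtain x :: "nat \<Rightarrow> real" and \<theta> where x1: "(\<Sum>j<n. (x j)\<^sup>2) = 1" and \<theta>: "\<theta>1 \<le> \<theta>" "\<theta> \<le> D"
    and xG: "\<And>i. i \<in> I \<Longrightarrow> sum x (G i) = 0" and GP: "G \<in> I \<rightarrow>\<^sub>E half_sets n"
    and near: "near n K (\<lambda>j. \<theta> * x j)"
    and far: "\<And>\<theta>'. \<theta>0 \<le> \<theta>' \<Longrightarrow> \<theta>' < \<theta> / 2 \<Longrightarrow> \<not> near n K (\<lambda>j. \<theta>' * x j)"
    using G by (auto simp: structured_kernel_def)
  have \<theta>pos: "\<theta> > 0" using \<theta> \<theta>1 by linarith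
  obtain \<psi> :: real and k :: "nat \<Rightarrow> int"
    where \<psi>: "\<bar>\<psi>\<bar> \<le> 1/2" and k: "(\<Sum>j<n. (\<theta> * x j + \<psi> - k j)\<^sup>2) \<le> K"
    using near_shift_small[OF near] .
  define y where "y j = \<theta> * x j + \<psi>" for j
  have yV: "(\<Sum>j<n. \<bar>y j - real_of_int (k j)\<bar>) \<le> V"
    unfolding V using k by (intro sum_abs_le_sqrt) (simp add: y_def)
  have cG: "real (card (G i)) = n / 2" if "i \<in> I" for i
  proof -
    have "G i \<in> half_sets n" using GP that by auto
    then show ?thesis using n(1) card_half_set by (auto elim!: evenE)
  qed
  have yG: "sum y (G i) = \<psi> * (n / 2)" if "i \<in> I" for i
    using xG[OF that] cG[OF that] by (simp add: y_def sum.distrib sum_distrib_left[symmetric] mult.commute)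
  define b where "b = \<lfloor>\<psi> * (n / 2)\<rfloor>"
  obtain w where w: "w \<in> extensional {..<n}"
     "(\<Sum>i\<in>I. ((\<Sum>j\<in>G i. real_of_int (w j)) - b)\<^sup>2) \<le> 4 * real n * V + 2 * real n"
     "L2_set (\<lambda>j. w j - y j) {..<n} \<le> sqrt (2 * V)"
    using round_on_half_sets[OF I GP yG yV] unfolding b_def by blast
  \<comment> \<open>The real target is at most n / 4 in size and the floor can add 1; an even
    positive n is at least 2, which leaves enough room.\<close>
  have bn: "\<bar>b\<bar> \<le> int n"
  proof -
    have "\<bar>\<psi> * (n / 2)\<bar> \<le> 1/2 * (n / 2)" using mult_right_mono[OF \<psi>, of "real n"] by (simp add: abs_mult)
    moreover have "real n \<ge> 2" using n by (auto elim!: evenE)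
    ultimately have "\<bar>\<psi> * (n / 2)\<bar> \<le> real n - 1" by linarith
    then show ?thesis unfolding b_def by linarith
  qed
  have wn: "L2_set w {..<n} \<le> \<theta> + sqrt n / 2 + sqrt (2 * V)"
  proof -
    have "L2_set w {..<n} = L2_set (\<lambda>j. (w j - y j) + (\<theta> * x j + \<psi>)) {..<n}"
      by (simp add: y_def)
    also have "\<dots> \<le> L2_set (\<lambda>j. w j - y j) {..<n} + L2_set (\<lambda>j. \<theta> * x j + \<psi>) {..<n}" by (rule L2_set_triangle_ineq)
    also have "L2_set (\<lambda>j. \<theta> * x j + \<psi>) {..<n} \<le> L2_set (\<lambda>j. \<theta> * x j) {..<n} + L2_set (\<lambda>j. \<psi>) {..<n}"
      by (rule L2_set_triangle_ineq)
    also have "L2_set (\<lambda>j. \<theta> * x j) {..<n} = \<theta> * L2_set x {..<n}"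
      using \<theta>pos by (intro L2_set_right_distrib[symmetric]) auto
    also have "L2_set x {..<n} = 1" using x1 by (simp add: L2_set_def)
    also have "L2_set (\<lambda>j. \<psi>) {..<n} \<le> sqrt n / 2"
      using mult_left_mono[OF \<psi>, of "sqrt n"] by (simp add: L2_set_constant)
    finally show ?thesis using w(3) by linarith
  qed
  have wfar: "\<not> near n (K / 4) (\<lambda>j. v * real_of_int (w j))"
    if v: "\<theta>0 / \<theta> \<le> v" "0 < v" "v < 1/2" "v * sqrt (2 * V) \<le> sqrt K / 2" for v :: real
  proof
    assume "near n (K / 4) (\<lambda>j. v * real_of_int (w j))"
    then obtain \<psi>' :: real and k' :: "nat \<Rightarrow> int" where "(\<Sum>j<n. (v * w j + \<psi>' - k' j)\<^sup>2) \<le> K / 4"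
      by (auto simp: near_def)
    then have "sqrt (\<Sum>j<n. (v * w j + \<psi>' - k' j)\<^sup>2) \<le> sqrt (K / 4)" by simp
    then have k': "L2_set (\<lambda>j. v * w j + \<psi>' - k' j) {..<n} \<le> sqrt K / 2"
      by (simp add: L2_set_def real_sqrt_divide)
    have "L2_set (\<lambda>j. v * \<theta> * x j + (v * \<psi> + \<psi>') - k' j) {..<n}
       = L2_set (\<lambda>j. (v * w j + \<psi>' - k' j) + v * (y j - w j)) {..<n}"
      by (simp add: y_def algebra_simps)
    also have "\<dots> \<le> L2_set (\<lambda>j. v * w j + \<psi>' - k' j) {..<n} + L2_set (\<lambda>j. v * (y j - w j)) {..<n}"
      by (rule L2_set_triangle_ineq)
    also have "L2_set (\<lambda>j. v * (y j - w j)) {..<n} = v * L2_set (\<lambda>j. y j - w j) {..<n}"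
      using v(2) by (intro L2_set_right_distrib[symmetric]) auto
    also have "L2_set (\<lambda>j. y j - w j) {..<n} = L2_set (\<lambda>j. w j - y j) {..<n}"
      unfolding L2_set_def by (simp add: power2_commute)
    also have "v * \<dots> \<le> v * sqrt (2 * V)" using w(3) v(2) by (intro mult_left_mono) auto
    finally have "L2_set (\<lambda>j. v * \<theta> * x j + (v * \<psi> + \<psi>') - k' j) {..<n} \<le> sqrt K" using k' v(4) by linarith
    then have "near n K (\<lambda>j. v * \<theta> * x j)" using K by (intro near_of_L2_set) auto
    moreover have "\<theta>0 \<le> v * \<theta>" using v(1) \<theta>pos by (simp add: pos_divide_le_eq)
    moreover have "v * \<theta> < \<theta> / 2" using v(3) \<theta>pos by simp
    ultimately show False using far by blast
  qed
  show ?thesis by (rule that[OF w(1,2) bn \<theta> wn wfar])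
qed

section \<open>Weighted counting of integer vectors\<close>

text \<open>The inequality of arithmetic and geometric means, then Cauchy-Schwarz. It trades a power
  of the norm for a product over coordinates, over which sums factorize.\<close>

lemma prod_one_plus_abs_le:
  fixes f :: "nat \<Rightarrow> real"
  assumes "n > 0"
  shows "(\<Prod>j<n. 1 + \<bar>f j\<bar>) \<le> (1 + L2_set f {..<n} / sqrt n) ^ n"
proof -
  let ?P = "\<Prod>j<n. 1 + \<bar>f j\<bar>"
  have P: "?P > 0" by (intro prod_pos) (auto intro: add_pos_nonneg)
  have "?P powr (1 / n) \<le> (\<Sum>j<n. (1 + \<bar>f j\<bar>) / n)"
    using arith_geom_mean[of "{..<n}" "\<lambda>j. 1 + \<bar>f j\<bar>"] assms by auto
  also have "\<dots> = 1 + (\<Sum>j<n. \<bar>f j\<bar>) / n"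
    using assms by (simp add: add_divide_distrib sum.distrib sum_divide_distrib)
  also have "(\<Sum>j<n. \<bar>f j\<bar>) \<le> sqrt n * L2_set f {..<n}"
    using sum_abs_le_sqrt[OF order.refl, of f n] by (simp add: L2_set_def real_sqrt_mult)
  also have "sqrt n * L2_set f {..<n} / n = L2_set f {..<n} / sqrt n"
    using assms by (simp add: field_simps flip: power2_eq_square)
  finally have "?P powr (1 / n) \<le> 1 + L2_set f {..<n} / sqrt n" using assms by (simp add: divide_right_mono)
  then have "(?P powr (1 / n)) ^ n \<le> (1 + L2_set f {..<n} / sqrt n) ^ n" by (intro power_mono) auto
  moreover have "(?P powr (1 / n)) ^ n = ?P" 
  proof -
    have "(?P powr (1 / n)) ^ n = (?P powr (1 / n)) powr n"
      using P by (intro powr_realpow[symmetric]) auto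
    then show ?thesis using P assms by (simp add: powr_powr)
  qed
  ultimately show ?thesis by simp
qed

lemma harm_le_one_plus_ln: "n > 0 \<Longrightarrow> harm n \<le> 1 + ln (real n)"
  using decseqD[OF decseq_harm_diff_ln, of 0 "n - 1"] by (simp add: harm_expand)

lemma sum_inverse_int_le:
  "(\<Sum>k\<in>{- int m..int m}. 1 / (1 + \<bar>real_of_int k\<bar>)) \<le> 2 * (1 + ln (real m + 1))"
proof -
  let ?f = "\<lambda>k::int. 1 / (1 + \<bar>real_of_int k\<bar>)"
  have h: "(\<Sum>i\<le>m. 1 / (1 + real i)) = harm (Suc m)"
    by (simp add: harm_altdef lessThan_Suc_atMost inverse_eq_divide add.commute)
  have "{- int m..int m} \<subseteq> int ` {..m} \<union> (\<lambda>i. - int i) ` {..m}"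
  proof
    fix k assume "k \<in> {- int m..int m}"
    then show "k \<in> int ` {..m} \<union> (\<lambda>i. - int i) ` {..m}"
      by (cases k rule: int_cases2) auto
  qed
  then have "sum ?f {- int m..int m} \<le> sum ?f (int ` {..m} \<union> (\<lambda>i. - int i) ` {..m})"
    by (intro sum_mono2) auto
  also have "\<dots> \<le> sum ?f (int ` {..m}) + sum ?f ((\<lambda>i. - int i) ` {..m})"
    by (subst sum.union_inter[symmetric]) (auto intro!: sum_nonneg)
  also have "sum ?f (int ` {..m}) = harm (Suc m)" by (subst sum.reindex) (auto simp: h)
  also have "sum ?f ((\<lambda>i. - int i) ` {..m}) = harm (Suc m)" by (subst sum.reindex) (auto simp: h inj_on_def)
  finally show ?thesis using harm_le_one_plus_ln[of "Suc m"] by (simp add: add.commute)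
qed

text \<open>No splitting according to the norm of w is needed: with s = 1 + |w| / sqrt n, the weight
  s^(-n) is at most the product of 1 / (1 + |w j|), so the sum over the box factorizes and costs one
  harmonic sum per coordinate. One factor s \<le> 1 + m makes up for the exponent n - 1.\<close>

lemma sum_box_le:
  fixes n m :: nat
  assumes n: "n > 0" and g: "g \<ge> 0"
  shows "(\<Sum>w\<in>{w \<in> {..<n} \<rightarrow>\<^sub>E {- int m..int m}. L2_set w {..<n} \<le> sqrt n * m}. (g / (1 + L2_set w {..<n} / sqrt n)) ^ (n - 1))
     \<le> g ^ (n - 1) * (1 + real m) * (2 * (1 + ln (real m + 1))) ^ n"
proof -
  let ?B = "{..<n} \<rightarrow>\<^sub>E {- int m..int m}"
  have "(\<Sum>w\<in>{w \<in> ?B. L2_set w {..<n} \<le> sqrt n * m}. (g / (1 + L2_set w {..<n} / sqrt n)) ^ (n - 1))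
    \<le> (\<Sum>w\<in>{w \<in> ?B. L2_set w {..<n} \<le> sqrt n * m}. g ^ (n - 1) * (1 + real m) * (\<Prod>j<n. 1 / (1 + \<bar>real_of_int (w j)\<bar>)))"
  proof (intro sum_mono)
    fix w assume w: "w \<in> {w \<in> ?B. L2_set w {..<n} \<le> sqrt n * m}"
    define s where "s = 1 + L2_set w {..<n} / sqrt n"
    have s: "s > 0" by (simp add: s_def add_pos_nonneg)
    have sm: "s \<le> 1 + real m" using w n by (simp add: s_def divide_le_eq mult.commute)
    have P: "(\<Prod>j<n. 1 + \<bar>real_of_int (w j)\<bar>) > 0" by (intro prod_pos) (auto intro: add_pos_nonneg)
    have "(1 / s) ^ (n - 1) = s * (1 / s ^ n)"
    proof -
      obtain k where "n = Suc k" using n gr0_implies_Suc by blast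
      then show ?thesis using s by (simp add: power_one_over)
    qed
    also have "\<dots> \<le> (1 + real m) * (1 / (\<Prod>j<n. 1 + \<bar>real_of_int (w j)\<bar>))"
      using sm s P prod_one_plus_abs_le[OF n, of "\<lambda>j. real_of_int (w j)"]
      by (intro mult_mono divide_left_mono) (auto simp: s_def)
    also have "1 / (\<Prod>j<n. 1 + \<bar>real_of_int (w j)\<bar>) = (\<Prod>j<n. 1 / (1 + \<bar>real_of_int (w j)\<bar>))"
      by (simp add: prod_dividef)
    finally have "g ^ (n - 1) * (1 / s) ^ (n - 1)
       \<le> g ^ (n - 1) * ((1 + real m) * (\<Prod>j<n. 1 / (1 + \<bar>real_of_int (w j)\<bar>)))"
      using g by (intro mult_left_mono) auto
    then show "(g / (1 + L2_set w {..<n} / sqrt n)) ^ (n - 1)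
       \<le> g ^ (n - 1) * (1 + real m) * (\<Prod>j<n. 1 / (1 + \<bar>real_of_int (w j)\<bar>))"
      by (simp add: s_def power_divide mult.assoc)
  qed
  also have "\<dots> \<le> (\<Sum>w\<in>?B. g ^ (n - 1) * (1 + real m) * (\<Prod>j<n. 1 / (1 + \<bar>real_of_int (w j)\<bar>)))"
  proof (rule sum_mono2)
    show "finite ?B" by (intro finite_PiE) auto
    show "0 \<le> g ^ (n - 1) * (1 + real m) * (\<Prod>j<n. 1 / (1 + \<bar>real_of_int (w j)\<bar>))" for w :: "nat \<Rightarrow> int"
      using g by (intro mult_nonneg_nonneg prod_nonneg ballI zero_le_power) auto
  qed blast
  also have "\<dots> = g ^ (n - 1) * (1 + real m) * (\<Prod>j<n. \<Sum>k\<in>{- int m..int m}. 1 / (1 + \<bar>real_of_int k\<bar>))"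
    by (subst prod_sum_PiE) (auto simp: sum_distrib_left)
  also have "\<dots> \<le> g ^ (n - 1) * (1 + real m) * (\<Prod>j<n. 2 * (1 + ln (real m + 1)))"
    using g by (intro mult_left_mono prod_mono conjI sum_inverse_int_le) (auto intro!: sum_nonneg)
  finally show ?thesis by simp
qed

text \<open>The scale r = sqrt V matches the typical rounding error, so M / r^2 \<le> 6 n. The union
  bound runs over w and b but not over \<theta>; therefore the concentration bound, of order r
  \<theta>0 / \<theta>, is first rewritten as \<open>h w\<close> in terms of the norm of w, and then
  summed with these weights.\<close>

lemma card_structured_kernel_le:
  fixes I :: "'i set" and m :: nat and K V D \<theta>0 \<theta>1 g :: real
  assumes n: "even n" "n > 0" and I: "finite I" "card I = n - 1"
    and K: "K > 0" and V: "V = sqrt (n * K)" "V \<ge> 1" "K \<le> V" "sqrt (2 * V) \<le> sqrt n / 2"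
    and \<theta>: "\<theta>0 > 0" "\<theta>1 > 0" "D > 0"
    and small: "n * exp (- (K / 4)) + 2 * exp (- sqrt K) \<le> sqrt V * \<theta>0 / D"
    and m: "D + 2 * sqrt n \<le> m"
    and g: "g = 8 * sqrt V * \<theta>0 * (1 + 2 * sqrt n / \<theta>1) / sqrt n"
  shows "card (structured_kernel n I K \<theta>0 \<theta>1 D) \<le> (2 * real n + 1) * exp (6 * real n)
     * (g ^ (n - 1) * (1 + real m) * (2 * (1 + ln (real m + 1))) ^ n) * real (card (half_sets n)) ^ (n - 1)"
proof -
  define r where "r = sqrt V"
  have r: "r > 0" "r\<^sup>2 = V" using V by (auto simp: r_def)
  define M where "M = 4 * real n * V + 2 * real n"
  define h where "h w = g / (1 + L2_set (\<lambda>j. real_of_int (w j)) {..<n} / sqrt n)" for w :: "nat \<Rightarrow> int"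
  define W where "W = {w \<in> {w \<in> {..<n} \<rightarrow>\<^sub>E {- int m..int m}. L2_set w {..<n} \<le> sqrt n * m}.
      \<forall>b. smooth_conc n r (\<lambda>j. real_of_int (w j)) b \<le> h w}"
  define T where "T = (\<lambda>(w, b::int). {G \<in> I \<rightarrow>\<^sub>E half_sets n. (\<Sum>i\<in>I. (sum (\<lambda>j. real_of_int (w j)) (G i) - b)\<^sup>2) \<le> M})"
  have g0: "g \<ge> 0" unfolding g using V \<theta> by (intro divide_nonneg_nonneg mult_nonneg_nonneg add_nonneg_nonneg) auto
  have h0: "h w \<ge> 0" for w
    unfolding h_def using g0 by (intro divide_nonneg_nonneg add_nonneg_nonneg) auto
  have finW: "finite W" unfolding W_def by (rule finite_subset[of _ "{..<n} \<rightarrow>\<^sub>E {- int m..int m}"]) (blast, intro finite_PiE, auto)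
  have I_le: "card I \<le> n" using I by simp
  have n1: "sqrt n \<ge> 1" using n by simp
  have "structured_kernel n I K \<theta>0 \<theta>1 D \<subseteq> (\<Union>z\<in>W \<times> {- int n..int n}. T z)"
  proof
    fix G assume G: "G \<in> structured_kernel n I K \<theta>0 \<theta>1 D"
    then have GP: "G \<in> I \<rightarrow>\<^sub>E half_sets n" by (simp add: structured_kernel_def)
    obtain w :: "nat \<Rightarrow> int" and b :: int and \<theta> where w: "w \<in> extensional {..<n}"
      "(\<Sum>i\<in>I. ((\<Sum>j\<in>G i. real_of_int (w j)) - b)\<^sup>2) \<le> M"
      and b: "\<bar>b\<bar> \<le> int n" and \<theta>': "\<theta>1 \<le> \<theta>" "\<theta> \<le> D"
      and wn: "L2_set w {..<n} \<le> \<theta> + sqrt n / 2 + sqrt (2 * V)"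
      and far: "\<And>v::real. \<theta>0 / \<theta> \<le> v \<Longrightarrow> 0 < v \<Longrightarrow> v < 1/2 \<Longrightarrow> v * sqrt (2 * V) \<le> sqrt K / 2 \<Longrightarrow> \<not> near n (K / 4) (\<lambda>j. v * real_of_int (w j))"
      by (rule structured_kernel_cover[OF n I(1) I_le K V(1) \<theta>(2) G]) (rule that; (assumption | simp add: M_def))
    have \<theta>pos: "\<theta> > 0" using \<theta>' \<theta> by linarith
    have wm: "L2_set w {..<n} \<le> m" using wn V(4) \<theta>'(2) m n1 by linarith
    have "\<bar>w j\<bar> \<le> int m" if "j < n" for j
    proof -
      have "\<bar>real_of_int (w j)\<bar> \<le> L2_set (\<lambda>j. \<bar>real_of_int (w j)\<bar>) {..<n}"
        using that by (intro member_le_L2_set) auto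
      also have "\<dots> = L2_set w {..<n}" by (simp add: L2_set_def)
      finally have "real_of_int \<bar>w j\<bar> \<le> real_of_int (int m)" using wm by simp
      then show ?thesis by (simp only: of_int_le_iff)
    qed
    then have "w \<in> {..<n} \<rightarrow>\<^sub>E {- int m..int m}" using w(1) by (auto simp: PiE_iff abs_le_iff minus_le_iff)
    moreover have "L2_set w {..<n} \<le> sqrt n * m"
      using wm mult_right_mono[OF n1, of "real m"] by simp
    moreover have "smooth_conc n r (\<lambda>j. real_of_int (w j)) b' \<le> h w" for b'
    proof -
      \<comment> \<open>The cut-off is A = sqrt K. As sqrt K \<le> r, it keeps v below 1/2 and v
        times the rounding error below sqrt K / 2, the two conditions under which minimality
        applies.\<close>
      have "smooth_conc n r (\<lambda>j. real_of_int (w j)) b'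
         \<le> 2 * pi * r * (\<theta>0 / \<theta>) + n * exp (- (K / 4)) + 2 * exp (- sqrt K)"
      proof (rule smooth_conc_le)
        fix v assume v: "\<theta>0 / \<theta> \<le> v" "v \<le> sqrt K / (2 * pi * r)"
        have "sqrt K \<le> r" using V by (simp add: r_def)
        then have "sqrt K / (2 * pi * r) \<le> r / (2 * pi * r)" using r by (intro divide_right_mono) auto
        also have "\<dots> < 1/2" using r pi_gt3 by (simp add: field_simps)
        finally have "v < 1/2" using v by linarith
        moreover have "\<theta>0 / \<theta> > 0" using \<theta> \<theta>pos by simp
        then have "v > 0" using v by linarith
        moreover have "v * sqrt (2 * V) \<le> sqrt K / 2"
        proof -
          have "v * sqrt (2 * V) \<le> sqrt K / (2 * pi * r) * sqrt (2 * V)" using v V by (intro mult_right_mono) auto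
          also have "\<dots> = sqrt K / 2 * (sqrt 2 / pi)" using r by (simp add: r_def real_sqrt_mult)
          also have "\<dots> \<le> sqrt K / 2 * 1"
          proof (intro mult_left_mono)
            have "sqrt 2 \<le> 2" by (intro real_le_lsqrt) auto
            then show "sqrt 2 / pi \<le> 1" using pi_gt3 by simp
          qed (use K in auto)
          finally show ?thesis by simp
        qed
        ultimately show "\<not> near n (K / 4) (\<lambda>j. v * real_of_int (w j))" using v by (intro far) auto
      qed (use n r K \<theta> \<theta>pos in auto)
      \<comment> \<open>The additive Fourier errors are absorbed here, using \<theta> \<le> D; this
        is what limits the size of D.\<close>
      also have "\<dots> \<le> 2 * pi * r * (\<theta>0 / \<theta>) + r * \<theta>0 / \<theta>"
      proof -
        have "r * \<theta>0 / D \<le> r * \<theta>0 / \<theta>" using r \<theta> \<theta>' \<theta>pos by (intro divide_left_mono) auto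
        then show ?thesis using small by (simp add: r_def)
      qed
      also have "\<dots> = (2 * pi + 1) * (r * \<theta>0 / \<theta>)" by (simp add: algebra_simps)
      also have "\<dots> \<le> 8 * (r * \<theta>0 / \<theta>)"
        using r \<theta> \<theta>pos pi_less_4 by (intro mult_right_mono) (use pi_approx in auto)
      also have "\<dots> = 8 * r * \<theta>0 * (1 / \<theta>)" by simp
      \<comment> \<open>The norm of w is at most \<theta> + sqrt n, so sqrt n plus this norm is at
        most \<theta> + 2 sqrt n, and 2 sqrt n \<le> (2 sqrt n / \<theta>1) \<theta>.\<close>
      also have "\<dots> \<le> 8 * r * \<theta>0 * ((1 + 2 * sqrt n / \<theta>1) / (sqrt n + L2_set w {..<n}))"
      proof (intro mult_left_mono)
        have "2 * sqrt n = 2 * sqrt n / \<theta>1 * \<theta>1" using \<theta> by simp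
        also have "\<dots> \<le> 2 * sqrt n / \<theta>1 * \<theta>" using \<theta>' \<theta> by (intro mult_left_mono) auto
        finally have "sqrt n + L2_set w {..<n} \<le> (1 + 2 * sqrt n / \<theta>1) * \<theta>"
          using wn V(4) by (simp add: algebra_simps)
        moreover have "sqrt n + L2_set w {..<n} > 0" using n1 by (intro add_pos_nonneg) auto
        ultimately show "1 / \<theta> \<le> (1 + 2 * sqrt n / \<theta>1) / (sqrt n + L2_set w {..<n})"
          using \<theta>pos by (simp add: frac_le_eq divide_simps)
      qed (use r \<theta> in auto)
      also have "\<dots> = h w"
      proof -
        have "sqrt n + L2_set w {..<n} = sqrt n * (1 + L2_set w {..<n} / sqrt n)"
          using n1 by (simp add: distrib_left)
        then show ?thesis by (simp add: h_def g r_def)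
      qed
      finally show ?thesis .
    qed
    ultimately show "G \<in> (\<Union>z\<in>W \<times> {- int n..int n}. T z)"
      using GP w(2) b by (intro UN_I[of "(w, b)"]) (auto simp: W_def T_def)
  qed
  moreover have finT: "finite (T z)" for z
  proof (rule finite_subset)
    show "T z \<subseteq> I \<rightarrow>\<^sub>E half_sets n" by (auto simp: T_def split: prod.splits)
    show "finite (I \<rightarrow>\<^sub>E half_sets n)" using I(1) by (intro finite_PiE) auto
  qed
  ultimately have "card (structured_kernel n I K \<theta>0 \<theta>1 D) \<le> card (\<Union>z\<in>W \<times> {- int n..int n}. T z)"
    using finW by (intro card_mono) auto
  also have "\<dots> \<le> (\<Sum>z\<in>W \<times> {- int n..int n}. card (T z))" using finW by (intro card_UN_le) auto
  finally have "real (card (structured_kernel n I K \<theta>0 \<theta>1 D)) \<le> (\<Sum>z\<in>W \<times> {- int n..int n}. real (card (T z)))"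
    by (metis of_nat_le_iff of_nat_sum)
  also have "\<dots> \<le> (\<Sum>z\<in>W \<times> {- int n..int n}. exp (6 * real n) * real (card (half_sets n)) ^ (n - 1) * h (fst z) ^ (n - 1))"
  proof (intro sum_mono)
    fix z assume "z \<in> W \<times> {- int n..int n}"
    then obtain w b where z: "z = (w, b)" "w \<in> W" by auto
    have "card (T z) \<le> exp (M / r\<^sup>2) * (smooth_conc n r (\<lambda>j. real_of_int (w j)) b * card (half_sets n)) ^ card I"
      unfolding z T_def prod.case by (rule tensorize[OF I(1) r(1)])
    also have "\<dots> \<le> exp (6 * real n) * (h w * card (half_sets n)) ^ card I"
    proof (intro mult_mono power_mono mult_right_mono)
      have "2 * real n \<le> 2 * real n * V" using mult_left_mono[OF V(2), of "2 * real n"] by simp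
      then have "M / V \<le> 6 * real n" using V(2) by (simp add: M_def pos_divide_le_eq mult.commute)
      then show "exp (M / r\<^sup>2) \<le> exp (6 * real n)" by (simp add: r)
    qed (use z(2) h0 in \<open>auto simp: W_def intro!: mult_nonneg_nonneg smooth_conc_nonneg zero_le_power\<close>)
    finally show "real (card (T z)) \<le> exp (6 * real n) * real (card (half_sets n)) ^ (n - 1) * h (fst z) ^ (n - 1)"
      by (simp add: z I power_mult_distrib mult_ac)
  qed
  also have "\<dots> = (\<Sum>w\<in>W. \<Sum>b\<in>{- int n..int n}. exp (6 * real n) * real (card (half_sets n)) ^ (n - 1) * h w ^ (n - 1))"
    by (subst sum.cartesian_product) (simp add: case_prod_unfold)
  also have "\<dots> = (2 * real n + 1) * exp (6 * real n) * (\<Sum>w\<in>W. h w ^ (n - 1)) * real (card (half_sets n)) ^ (n - 1)"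
    by (simp add: sum_distrib_left sum_distrib_right mult_ac)
  also have "\<dots> \<le> (2 * real n + 1) * exp (6 * real n)
     * (g ^ (n - 1) * (1 + real m) * (2 * (1 + ln (real m + 1))) ^ n) * real (card (half_sets n)) ^ (n - 1)"
  proof (intro mult_right_mono mult_left_mono)
    have "(\<Sum>w\<in>W. h w ^ (n - 1)) \<le> (\<Sum>w\<in>{w \<in> {..<n} \<rightarrow>\<^sub>E {- int m..int m}. L2_set w {..<n} \<le> sqrt n * m}. h w ^ (n - 1))"
    proof (intro sum_mono2)
      show "finite {w \<in> {..<n} \<rightarrow>\<^sub>E {- int m..int m}. L2_set w {..<n} \<le> sqrt n * m}"
        by (rule finite_subset[of _ "{..<n} \<rightarrow>\<^sub>E {- int m..int m}"]) (blast, intro finite_PiE, auto)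
      show "0 \<le> h w ^ (n - 1)" for w
        by (intro zero_le_power h0)
    qed (auto simp: W_def)
    also have "\<dots> \<le> g ^ (n - 1) * (1 + real m) * (2 * (1 + ln (real m + 1))) ^ n"
      unfolding h_def by (rule sum_box_le[OF n(2) g0])
    finally show "(\<Sum>w\<in>W. h w ^ (n - 1)) \<le> g ^ (n - 1) * (1 + real m) * (2 * (1 + ln (real m + 1))) ^ n" .
  qed auto
  finally show ?thesis .
qed

section \<open>Reduction to a single row\<close>

text \<open>Row i is the one with the largest coefficient, so |y i| is at least the norm of y over
  sqrt n. Since every unit normal x of the other rows is covered, a normal can later be fixed from
  those rows alone, independently of row i.\<close>

lemma least_singular_value_row:
  fixes M :: "real Matrix.mat" and n :: nat and \<eta> :: real
  assumes M: "M \<in> carrier_mat n n" and n: "n > 0" and \<eta>: "\<eta> > 0" and le: "least_singular_value M \<le> \<eta>"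
  shows "\<exists>i<n. \<forall>x::nat \<Rightarrow> real. (\<Sum>j<n. (x j)\<^sup>2) = 1 \<longrightarrow> (\<forall>l<n. l \<noteq> i \<longrightarrow> (\<Sum>j<n. M $$ (l, j) * x j) = 0)
     \<longrightarrow> \<bar>\<Sum>j<n. M $$ (i, j) * x j\<bar> \<le> 2 * \<eta> * sqrt n"
proof -
  have dim: "dim_col M = n" "dim_row M = n" using M by auto
  have "unit_vec n 0 \<in> unit_sphere_vec n"
    using n by (simp add: unit_sphere_vec_def l2_norm_vec_def L2_set_def unit_vec_def if_distrib[of "\<lambda>c. c\<^sup>2"] cong: if_cong)
  then have ne: "(\<lambda>x. l2_norm_vec (M *\<^sub>v x)) ` unit_sphere_vec n \<noteq> {}" by blast
  \<comment> \<open>The factor 2 gives a strict inequality, hence an actual unit vector z in place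
    of the infimum.\<close>
  have "(INF x\<in>unit_sphere_vec n. l2_norm_vec (M *\<^sub>v x)) < 2 * \<eta>"
    using le \<eta> by (simp add: least_singular_value_def dim)
  from cInf_lessD[OF ne this] obtain z where z: "z \<in> unit_sphere_vec n" "l2_norm_vec (M *\<^sub>v z) < 2 * \<eta>"
    by auto
  have zc: "z \<in> carrier_vec n" and z1: "(\<Sum>j<n. (z $ j)\<^sup>2) = 1"
    using z(1) by (auto simp: unit_sphere_vec_def l2_norm_vec_def L2_set_def atLeast0LessThan)
  define u where "u i = (\<Sum>j<n. M $$ (i, j) * z $ j)" for i
  have Mz: "(M *\<^sub>v z) $ i = u i" if "i < n" for i
    using that M zc by (simp add: u_def scalar_prod_def atLeast0LessThan)
  have u2: "L2_set u {..<n} < 2 * \<eta>"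
    using z(2) Mz dim by (simp add: l2_norm_vec_def atLeast0LessThan cong: L2_set_cong_simp)
  text \<open>Either the rows are dependent, or \<open>z\<close> is the combination of the rows with
    coefficients \<open>y\<close>, and then \<open>1 = z \<bullet> z = y \<bullet> M z\<close> forces \<open>y\<close> to be long.\<close>
  have "\<exists>y g. (\<exists>i<n. y i \<noteq> 0) \<and> (\<forall>j<n. (\<Sum>i<n. y i * M $$ (i, j)) = g j) \<and> (g = (\<lambda>_. 0) \<or> g = vec_index z)"
  proof (cases "det M = 0")
    case True
    then have "det (transpose_mat M) = 0" using M by (simp add: det_transpose)
    then obtain v where v: "v \<in> carrier_vec n" "v \<noteq> 0\<^sub>v n" "transpose_mat M *\<^sub>v v = 0\<^sub>v n"
      using det_0_iff_vec_prod_zero_field[of "transpose_mat M" n] M by auto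
    have "\<exists>i<n. v $ i \<noteq> 0" using v(1,2) by (metis carrier_vecD eq_vecI index_zero_vec)
    moreover have "(\<Sum>i<n. v $ i * M $$ (i, j)) = 0" if "j < n" for j
    proof -
      have "(transpose_mat M *\<^sub>v v) $ j = (\<Sum>i<n. M $$ (i, j) * v $ i)"
        using that M v(1) by (simp add: scalar_prod_def atLeast0LessThan)
      then show ?thesis using that v(3) by (simp add: mult.commute)
    qed
    ultimately show ?thesis by (intro exI[of _ "vec_index v"] exI[of _ "\<lambda>_. 0"]) auto
  next
    case False
    then have "det (transpose_mat M) \<noteq> 0" using M by (simp add: det_transpose)
    then have "transpose_mat M \<in> Units (ring_mat TYPE(real) n n)"
      using det_non_zero_imp_unit[of "transpose_mat M" n] M by auto
    then obtain B where B: "B \<in> carrier_mat n n" "transpose_mat M * B = 1\<^sub>m n"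
      unfolding Units_def ring_mat_def by auto
    define v where "v = B *\<^sub>v z"
    have v: "v \<in> carrier_vec n" using B zc by (simp add: v_def)
    have "transpose_mat M *\<^sub>v v = (transpose_mat M * B) *\<^sub>v z"
      unfolding v_def using M B zc by (intro assoc_mult_mat_vec[symmetric]) auto
    also have "\<dots> = z" using B zc by simp
    finally have vz: "transpose_mat M *\<^sub>v v = z" .
    have eq: "(\<Sum>i<n. v $ i * M $$ (i, j)) = z $ j" if "j < n" for j
    proof -
      have "(transpose_mat M *\<^sub>v v) $ j = (\<Sum>i<n. M $$ (i, j) * v $ i)"
        using that M v by (simp add: scalar_prod_def atLeast0LessThan)
      then show ?thesis using vz by (simp add: mult.commute)
    qed
    moreover have "\<exists>i<n. v $ i \<noteq> 0"
    proof (rule ccontr)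
      assume "\<not> ?thesis"
      then have "z $ j = 0" if "j < n" for j using eq[OF that] by simp
      then show False using z1 by simp
    qed
    ultimately show ?thesis by (intro exI[of _ "vec_index v"] exI[of _ "vec_index z"]) auto
  qed
  then obtain y g where yg': "(\<exists>i<n. y i \<noteq> 0) \<and> (\<forall>j<n. (\<Sum>i<n. y i * M $$ (i, j)) = g j) \<and> (g = (\<lambda>_. 0) \<or> g = vec_index z)"
    by (elim exE) (rule that)
  note y = conjunct1[OF yg'] and g = conjunct2[OF conjunct2[OF yg']]
  have yg: "(\<Sum>i<n. y i * M $$ (i, j)) = g j" if "j < n" for j
    using conjunct1[OF conjunct2[OF yg']] that by simp
  obtain i where i: "i < n" "\<And>l. l < n \<Longrightarrow> \<bar>y l\<bar> \<le> \<bar>y i\<bar>"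
  proof -
    have "finite ((\<lambda>l. \<bar>y l\<bar>) ` {..<n})" "(\<lambda>l. \<bar>y l\<bar>) ` {..<n} \<noteq> {}" using n by auto
    from Max_in[OF this] Max_ge[OF this(1)] that show ?thesis by (smt (verit) image_iff imageI lessThan_iff)
  qed
  have yi: "\<bar>y i\<bar> > 0" 
  proof -
    obtain l where "l < n" "y l \<noteq> 0" using y by auto
    then show ?thesis using i(2)[of l] by linarith
  qed
  have pair: "(\<Sum>l<n. y l * (\<Sum>j<n. M $$ (l, j) * x j)) = (\<Sum>j<n. g j * x j)" for x :: "nat \<Rightarrow> real"
  proof -
    have "(\<Sum>l<n. y l * (\<Sum>j<n. M $$ (l, j) * x j)) = (\<Sum>j<n. (\<Sum>l<n. y l * M $$ (l, j)) * x j)"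
      unfolding sum_distrib_left sum_distrib_right by (subst sum.swap) (simp add: mult.assoc)
    then show ?thesis using yg by simp
  qed
  have "\<bar>\<Sum>j<n. M $$ (i, j) * x j\<bar> \<le> 2 * \<eta> * sqrt n"
    if x1: "(\<Sum>j<n. (x j)\<^sup>2) = 1" and orth: "\<forall>l<n. l \<noteq> i \<longrightarrow> (\<Sum>j<n. M $$ (l, j) * x j) = 0" for x :: "nat \<Rightarrow> real"
  proof -
    have "(\<Sum>l<n. y l * (\<Sum>j<n. M $$ (l, j) * x j)) = (\<Sum>l\<in>{i}. y l * (\<Sum>j<n. M $$ (l, j) * x j))"
      using orth i(1) by (intro sum.mono_neutral_right) auto
    then have gx: "(\<Sum>j<n. g j * x j) = y i * (\<Sum>j<n. M $$ (i, j) * x j)" using pair[of x] by simp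
    from g show ?thesis
    proof
      assume "g = (\<lambda>_. 0)"
      then have "(\<Sum>j<n. M $$ (i, j) * x j) = 0" using gx yi by simp
      then show ?thesis using \<eta> by simp
    next
      assume gz: "g = vec_index z"
      have "(\<Sum>j<n. g j * x j)\<^sup>2 \<le> (\<Sum>j<n. (z $ j)\<^sup>2) * (\<Sum>j<n. (x j)\<^sup>2)"
        unfolding gz by (rule Cauchy_Schwarz_ineq_sum)
      then have "\<bar>\<Sum>j<n. g j * x j\<bar> \<le> 1" using z1 x1 by (simp add: abs_square_le_1)
      then have a: "\<bar>y i\<bar> * \<bar>\<Sum>j<n. M $$ (i, j) * x j\<bar> \<le> 1" by (simp add: gx abs_mult)
      have "(\<Sum>l<n. y l * u l) = (\<Sum>j<n. (z $ j)\<^sup>2)"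
        using pair[of "vec_index z"] by (simp add: gz u_def power2_eq_square)
      then have "1 = (\<Sum>l<n. y l * u l)" using z1 by simp
      also have "\<dots> \<le> (\<Sum>l<n. \<bar>y l\<bar> * \<bar>u l\<bar>)" by (intro sum_mono) (metis abs_ge_self abs_mult)
      also have "\<dots> \<le> L2_set y {..<n} * L2_set u {..<n}" by (rule L2_set_mult_ineq)
      also have "\<dots> \<le> (sqrt n * \<bar>y i\<bar>) * (2 * \<eta>)"
      proof (intro mult_mono)
        have "(\<Sum>l<n. (y l)\<^sup>2) \<le> (\<Sum>l<n. (\<bar>y i\<bar>)\<^sup>2)"
          using i(2) by (intro sum_mono) (simp add: abs_le_square_iff)
        then have "sqrt (\<Sum>l<n. (y l)\<^sup>2) \<le> sqrt (n * (\<bar>y i\<bar>)\<^sup>2)" by (simp del: power2_abs)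
        then show "L2_set y {..<n} \<le> sqrt n * \<bar>y i\<bar>" by (simp add: L2_set_def real_sqrt_mult del: power2_abs)
      qed (use u2 in auto)
      finally have "1 \<le> \<bar>y i\<bar> * (2 * \<eta> * sqrt n)" by (simp add: mult_ac)
      with a have "\<bar>y i\<bar> * \<bar>\<Sum>j<n. M $$ (i, j) * x j\<bar> \<le> \<bar>y i\<bar> * (2 * \<eta> * sqrt n)" by linarith
      then show ?thesis using yi by (simp add: mult_le_cancel_left_pos)
    qed
  qed
  then show ?thesis using i(1) by blast
qed

text \<open>With row i replaced by zero the matrix is singular, and a null vector can be
  normalized.\<close>

lemma exists_unit_orthogonal:
  fixes a :: "nat \<Rightarrow> nat \<Rightarrow> real" and n i :: nat
  assumes "i < n"
  shows "\<exists>x::nat \<Rightarrow> real. (\<Sum>j<n. (x j)\<^sup>2) = 1 \<and> (\<forall>l<n. l \<noteq> i \<longrightarrow> (\<Sum>j<n. a l j * x j) = 0)"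
proof -
  define A where "A = Matrix.mat n n (\<lambda>(l, j). if l = i then 0 else a l j)"
  have A: "A \<in> carrier_mat n n" by (simp add: A_def)
  have "det (transpose_mat A) = 0"
  proof -
    have "transpose_mat A *\<^sub>v unit_vec n i = 0\<^sub>v n"
      using assms by (intro eq_vecI) (auto simp: A_def scalar_prod_def unit_vec_def if_distrib[of "(*) _"] cong: if_cong)
    moreover have "unit_vec n i \<noteq> (0\<^sub>v n :: real Matrix.vec)" using assms
      by (metis index_unit_vec(1) index_zero_vec(1) zero_neq_one)
    ultimately show ?thesis using A by (subst det_0_iff_vec_prod_zero_field) (auto intro!: exI[of _ "unit_vec n i"])
  qed
  then have "det A = 0" using A by (simp add: det_transpose)
  then obtain v where v: "v \<in> carrier_vec n" "v \<noteq> 0\<^sub>v n" "A *\<^sub>v v = 0\<^sub>v n"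
    using det_0_iff_vec_prod_zero_field[OF A] by auto
  obtain k where k: "k < n" "v $ k \<noteq> 0" using v(1,2) by (metis carrier_vecD eq_vecI index_zero_vec)
  define c where "c = sqrt (\<Sum>j<n. (v $ j)\<^sup>2)"
  have "(\<Sum>j<n. (v $ j)\<^sup>2) \<ge> (v $ k)\<^sup>2" using k by (intro member_le_sum) auto
  then have "(\<Sum>j<n. (v $ j)\<^sup>2) > 0" using k by (smt (verit) zero_less_power2)
  then have c: "c > 0" "c\<^sup>2 = (\<Sum>j<n. (v $ j)\<^sup>2)" by (auto simp: c_def)
  have "(\<Sum>j<n. (v $ j / c)\<^sup>2) = 1"
    using c(1) by (simp add: power_divide sum_divide_distrib[symmetric] c(2)[symmetric])
  moreover have "(\<Sum>j<n. a l j * (v $ j / c)) = 0" if l: "l < n" "l \<noteq> i" for l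
  proof -
    have "(A *\<^sub>v v) $ l = (\<Sum>j<n. a l j * v $ j)"
      using l v(1) by (auto simp: A_def scalar_prod_def atLeast0LessThan intro!: sum.cong)
    then have "(\<Sum>j<n. a l j * v $ j) = 0" using v(3) l by simp
    then show ?thesis by (simp add: sum_divide_distrib[symmetric])
  qed
  ultimately show ?thesis by (intro exI[of _ "\<lambda>j. v $ j / c"]) auto
qed

text \<open>These are the configurations of the other rows for which the Fourier bound may fail, at
  some frequency in the range, for some unit normal.\<close>

definition bad_rows :: "nat \<Rightarrow> 'i set \<Rightarrow> real \<Rightarrow> real \<Rightarrow> real \<Rightarrow> ('i \<Rightarrow> nat set) set" where
  "bad_rows n I K \<theta>0 D = {G \<in> I \<rightarrow>\<^sub>E half_sets n. \<exists>(x::nat \<Rightarrow> real) \<theta>.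
     (\<Sum>j<n. (x j)\<^sup>2) = 1 \<and> (\<forall>i\<in>I. sum x (G i) = 0) \<and> \<theta>0 \<le> \<theta> \<and> \<theta> \<le> D \<and> near n K (\<lambda>j. \<theta> * x j)}"

text \<open>An admissible value at most \<theta>1 puts x close to a constant. Otherwise the infimum
  of the admissible values is at least \<theta>1 > 0, hence less than twice itself, and an
  admissible value below that double is nearly minimal.\<close>

lemma bad_rows_subset:
  fixes d K \<theta>0 \<theta>1 D :: real
  assumes \<theta>: "0 < \<theta>0" "\<theta>0 \<le> \<theta>1" "K \<ge> 0" and d: "(sqrt (n * K) + 8 * K) / \<theta>0 + 8 * \<theta>1 \<le> d"
  shows "bad_rows n I K \<theta>0 D \<subseteq> flat_kernel n I d \<union> structured_kernel n I K \<theta>0 \<theta>1 D"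
proof
  fix G assume "G \<in> bad_rows n I K \<theta>0 D"
  then obtain x :: "nat \<Rightarrow> real" and \<theta> where G: "G \<in> I \<rightarrow>\<^sub>E half_sets n" and x1: "(\<Sum>j<n. (x j)\<^sup>2) = 1"
    and xG: "\<forall>i\<in>I. sum x (G i) = 0" and th: "\<theta>0 \<le> \<theta>" "\<theta> \<le> D" "near n K (\<lambda>j. \<theta> * x j)"
    by (auto simp: bad_rows_def)
  define \<Theta> where "\<Theta> = {\<theta>. \<theta>0 \<le> \<theta> \<and> \<theta> \<le> D \<and> near n K (\<lambda>j. \<theta> * x j)}"
  show "G \<in> flat_kernel n I d \<union> structured_kernel n I K \<theta>0 \<theta>1 D"
  proof (cases "\<exists>\<theta>\<in>\<Theta>. \<theta> \<le> \<theta>1")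
    case True
    then obtain t where t: "\<theta>0 \<le> t" "t \<le> \<theta>1" "near n K (\<lambda>j. t * x j)" by (auto simp: \<Theta>_def)
    have tpos: "t > 0" using t \<theta> by linarith
    obtain c where c: "(\<Sum>j<n. \<bar>x j - c\<bar>) \<le> (sqrt (n * K) + 8 * t\<^sup>2 + 8 * K) / t"
      using near_imp_close_to_constant[OF x1 tpos t(3)] by blast
    \<comment> \<open>One term decreases in t and is largest at \<theta>0, the other increases and
      is largest at \<theta>1.\<close>
    also have "\<dots> = (sqrt (n * K) + 8 * K) / t + 8 * t" using tpos by (simp add: field_simps power2_eq_square)
    also have "\<dots> \<le> (sqrt (n * K) + 8 * K) / \<theta>0 + 8 * \<theta>1"
      using t \<theta> tpos by (intro add_mono divide_left_mono) auto
    also note d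
    finally have "G \<in> flat_kernel n I d" using G x1 xG unfolding flat_kernel_def by blast
    then show ?thesis by simp
  next
    case False
    then have low: "\<theta>1 < t" if "t \<in> \<Theta>" for t using that by (auto simp: not_le)
    have ne: "\<Theta> \<noteq> {}" using th by (auto simp: \<Theta>_def)
    have bdd: "bdd_below \<Theta>" by (rule bdd_belowI[of _ \<theta>0]) (auto simp: \<Theta>_def)
    have "\<theta>1 \<le> Inf \<Theta>" using ne low by (intro cInf_greatest) (auto intro: less_imp_le)
    then have "Inf \<Theta> < 2 * Inf \<Theta>" using \<theta> by linarith
    from cInf_lessD[OF ne this] obtain t where t: "t \<in> \<Theta>" "t < 2 * Inf \<Theta>" by auto
    have "\<not> near n K (\<lambda>j. t' * x j)" if t': "\<theta>0 \<le> t'" "t' < t / 2" for t'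
    proof
      assume near: "near n K (\<lambda>j. t' * x j)"
      have "0 < t" using low[OF t(1)] \<theta> by linarith
      then have "t' \<le> D" using t' t(1) by (auto simp: \<Theta>_def)
      then have "t' \<in> \<Theta>" using near t' by (simp add: \<Theta>_def)
      then have "Inf \<Theta> \<le> t'" using bdd by (rule cInf_lower)
      then show False using t' t by linarith
    qed
    moreover have "\<theta>1 \<le> t" "t \<le> D" "near n K (\<lambda>j. t * x j)" using t low by (auto simp: \<Theta>_def intro: less_imp_le)
    ultimately have "G \<in> structured_kernel n I K \<theta>0 \<theta>1 D"
      using G x1 xG unfolding structured_kernel_def by blast
    then show ?thesis by simp
  qed
qed

section \<open>Row-regular matrices as families of half-sets\<close>

definition mat_of_rows_sets :: "nat \<Rightarrow> (nat \<Rightarrow> nat set) \<Rightarrow> real Matrix.mat" where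
  "mat_of_rows_sets n F = Matrix.mat n n (\<lambda>(i, j). if j \<in> F i then 1 else 0)"

lemma sum_row_mat_of_rows_sets:
  assumes "i < n" "F i \<subseteq> {..<n}"
  shows "(\<Sum>j<n. mat_of_rows_sets n F $$ (i, j) * x j) = sum x (F i)"
proof -
  have "(\<Sum>j<n. mat_of_rows_sets n F $$ (i, j) * x j) = (\<Sum>j<n. if j \<in> F i then x j else 0)"
    using assms(1) by (intro sum.cong) (auto simp: mat_of_rows_sets_def)
  also have "\<dots> = sum x (F i)" using assms(2) by (simp add: sum.If_cases Int_absorb1)
  finally show ?thesis .
qed

lemma bij_betw_row_regular_mats:
  assumes "even n"
  shows "bij_betw (mat_of_rows_sets n) ({..<n} \<rightarrow>\<^sub>E half_sets n) (row_regular_mats n)"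
proof (rule bij_betwI)
  define g where "g M = restrict (\<lambda>i. {j. j < n \<and> M $$ (i, j) = 1}) {..<n}" for M :: "real Matrix.mat"
  show "mat_of_rows_sets n \<in> ({..<n} \<rightarrow>\<^sub>E half_sets n) \<rightarrow> row_regular_mats n"
  proof
    fix F assume F: "F \<in> {..<n} \<rightarrow>\<^sub>E half_sets n"
    have "(\<Sum>j<n. mat_of_rows_sets n F $$ (i, j)) = real n / 2" if i: "i < n" for i
    proof -
      have Fi: "F i \<in> half_sets n" using F i by auto
      have "(\<Sum>j<n. mat_of_rows_sets n F $$ (i, j) * 1) = (\<Sum>j\<in>F i. 1)"
        by (rule sum_row_mat_of_rows_sets[of i n F "\<lambda>_. 1", OF i half_sets_subset[OF Fi]])
      then show ?thesis using card_half_set[OF Fi] assms by (auto elim!: evenE)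
    qed
    then show "mat_of_rows_sets n F \<in> row_regular_mats n"
      unfolding row_regular_mats_def by (auto simp: mat_of_rows_sets_def)
  qed
  show "g \<in> row_regular_mats n \<rightarrow> ({..<n} \<rightarrow>\<^sub>E half_sets n)"
  proof
    fix M assume M: "M \<in> row_regular_mats n"
    have "card {j. j < n \<and> M $$ (i, j) = 1} = n div 2" if i: "i < n" for i
    proof -
      have "(\<Sum>j<n. M $$ (i, j)) = (\<Sum>j<n. if M $$ (i, j) = 1 then 1 else 0)"
        using M i by (intro sum.cong) (auto simp: row_regular_mats_def)
      also have "\<dots> = card {j. j < n \<and> M $$ (i, j) = 1}"
        by (simp add: sum.If_cases Int_def)
      finally have "(\<Sum>j<n. M $$ (i, j)) = card {j. j < n \<and> M $$ (i, j) = 1}" .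
      moreover have "(\<Sum>j<n. M $$ (i, j)) = real n / 2"
        using M i by (simp add: row_regular_mats_def)
      ultimately have "real (card {j. j < n \<and> M $$ (i, j) = 1}) = real n / 2" by linarith
      then show ?thesis by linarith
    qed
    then show "g M \<in> {..<n} \<rightarrow>\<^sub>E half_sets n" by (auto simp: g_def half_sets_def)
  qed
  show "g (mat_of_rows_sets n F) = F" if F: "F \<in> {..<n} \<rightarrow>\<^sub>E half_sets n" for F
  proof (rule extensionalityI[of _ "{..<n}"])
    fix i assume i: "i \<in> {..<n}"
    then have "F i \<subseteq> {..<n}" using F half_sets_subset by (auto dest!: PiE_mem)
    then show "g (mat_of_rows_sets n F) i = F i" using i by (auto simp: g_def mat_of_rows_sets_def split: if_splits)
  qed (use F in \<open>auto simp: g_def PiE_def\<close>)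
  show "mat_of_rows_sets n (g M) = M" if "M \<in> row_regular_mats n" for M
  proof (rule eq_matI)
    have M: "M \<in> carrier_mat n n" "\<And>i j. i < n \<Longrightarrow> j < n \<Longrightarrow> M $$ (i, j) \<in> {0, 1}"
      using that unfolding row_regular_mats_def by blast+
    then show "dim_row (mat_of_rows_sets n (g M)) = dim_row M" "dim_col (mat_of_rows_sets n (g M)) = dim_col M"
      by (simp_all add: mat_of_rows_sets_def)
    fix i j assume "i < dim_row M" "j < dim_col M"
    then have "i < n" "j < n" using M(1) by auto
    then show "mat_of_rows_sets n (g M) $$ (i, j) = M $$ (i, j)"
      using M(2)[of i j] by (auto simp: mat_of_rows_sets_def g_def)
  qed
qed

lemma prob_row_regular:
  assumes "even n"
  shows "measure_pmf.prob (pmf_of_set (row_regular_mats n)) {Q. P Q}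
     = card {F \<in> {..<n} \<rightarrow>\<^sub>E half_sets n. P (mat_of_rows_sets n F)} / real (card (half_sets n)) ^ n"
proof -
  note bij = bij_betw_row_regular_mats[OF assms]
  have "card (row_regular_mats n) = card (half_sets n) ^ n"
    using bij_betw_same_card[OF bij] by (simp add: card_PiE)
  moreover have "row_regular_mats n \<inter> {Q. P Q} = mat_of_rows_sets n ` {F \<in> {..<n} \<rightarrow>\<^sub>E half_sets n. P (mat_of_rows_sets n F)}"
    using bij_betw_imp_surj_on[OF bij, symmetric] by auto
  moreover have "inj_on (mat_of_rows_sets n) {F \<in> {..<n} \<rightarrow>\<^sub>E half_sets n. P (mat_of_rows_sets n F)}"
    using bij_betw_imp_inj_on[OF bij] by (rule inj_on_subset) blast
  ultimately show ?thesis
    by (simp add: measure_pmf_of_set[OF row_regular_mats_nonempty[OF assms] finite_row_regular_mats] card_image)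
qed

text \<open>Conditioning on all rows but the i-th, as a count of pairs. The normal
  \<open>X G\<close> is chosen from the other rows only, so it stays fixed while row i runs through
  all half-sets; configurations in B are charged in full.\<close>

lemma card_row_event_le:
  fixes n i :: nat and t q \<beta> :: real
  assumes i: "i < n" and I: "I = {..<n} - {i}"
    and \<beta>: "card (B :: (nat \<Rightarrow> nat set) set) \<le> \<beta> * real (card (half_sets n)) ^ (n - 1)"
    and BI: "B \<subseteq> I \<rightarrow>\<^sub>E half_sets n" and q: "q \<ge> 0"
    and good: "\<And>G x. G \<in> (I \<rightarrow>\<^sub>E half_sets n) - B \<Longrightarrow> (\<Sum>j<n. (x j)\<^sup>2) = 1 \<Longrightarrow> (\<forall>l\<in>I. sum x (G l) = 0)
       \<Longrightarrow> card {S \<in> half_sets n. \<bar>sum x S\<bar> \<le> t} \<le> q * card (half_sets n)"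
  shows "card {F \<in> {..<n} \<rightarrow>\<^sub>E half_sets n. \<forall>x::nat \<Rightarrow> real. (\<Sum>j<n. (x j)\<^sup>2) = 1 \<longrightarrow> (\<forall>l\<in>I. sum x (F l) = 0) \<longrightarrow> \<bar>sum x (F i)\<bar> \<le> t}
     \<le> (\<beta> + q) * real (card (half_sets n)) ^ n"
proof -
  let ?H = "half_sets n"
  define N where "N = real (card ?H)"
  define E where "E = {F \<in> {..<n} \<rightarrow>\<^sub>E ?H. \<forall>x::nat \<Rightarrow> real. (\<Sum>j<n. (x j)\<^sup>2) = 1 \<longrightarrow> (\<forall>l\<in>I. sum x (F l) = 0) \<longrightarrow> \<bar>sum x (F i)\<bar> \<le> t}"
  have "\<exists>x::nat \<Rightarrow> real. (\<Sum>j<n. (x j)\<^sup>2) = 1 \<and> (\<forall>l\<in>I. sum x (G l) = 0)" if G: "G \<in> I \<rightarrow>\<^sub>E ?H" for G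
  proof -
    obtain x :: "nat \<Rightarrow> real" where x: "(\<Sum>j<n. (x j)\<^sup>2) = 1"
      "\<forall>l<n. l \<noteq> i \<longrightarrow> (\<Sum>j<n. mat_of_rows_sets n G $$ (l, j) * x j) = 0"
      using exists_unit_orthogonal[OF i, of "\<lambda>l j. mat_of_rows_sets n G $$ (l, j)"] by blast
    have "sum x (G l) = 0" if l: "l \<in> I" for l
    proof -
      have "G l \<in> ?H" using G l by auto
      then show ?thesis using x(2) l sum_row_mat_of_rows_sets[of l n G x] half_sets_subset by (auto simp: I)
    qed
    then show ?thesis using x(1) by blast
  qed
  then obtain X where X: "\<And>G. G \<in> I \<rightarrow>\<^sub>E ?H \<Longrightarrow> (\<Sum>j<n. (X G j :: real)\<^sup>2) = 1"
    "\<And>G. G \<in> I \<rightarrow>\<^sub>E ?H \<Longrightarrow> \<forall>l\<in>I. sum (X G) (G l) = 0" by metis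
  define R where "R G = (if G \<in> B then ?H else {S \<in> ?H. \<bar>sum (X G) S\<bar> \<le> t})" for G
  let ?P = "I \<rightarrow>\<^sub>E ?H"
  define f where "f F = (restrict F I, F i)" for F :: "nat \<Rightarrow> nat set"
  have finI: "finite I" "card I = n - 1" using i by (auto simp: I)
  have finP: "finite ?P" using finI by (intro finite_PiE) auto
  have "f ` E \<subseteq> Sigma ?P R"
  proof
    fix z assume "z \<in> f ` E"
    then obtain F where F: "F \<in> E" "z = f F" by blast
    have r: "restrict F I \<in> ?P" using F(1) by (auto simp: E_def I)
    have Fi: "F i \<in> ?H" using F(1) i by (auto simp: E_def)
    have "\<forall>l\<in>I. sum (X (restrict F I)) (F l) = 0" using X(2)[OF r] by simp
    then have "\<bar>sum (X (restrict F I)) (F i)\<bar> \<le> t" using F(1) X(1)[OF r] by (auto simp: E_def)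
    then show "z \<in> Sigma ?P R" using r Fi by (simp add: F(2) f_def R_def)
  qed
  moreover have "inj_on f E"
  proof (rule inj_onI)
    fix F F' assume F: "F \<in> E" "F' \<in> E" "f F = f F'"
    show "F = F'"
    proof (rule extensionalityI[of _ "{..<n}"])
      fix l assume "l \<in> {..<n}"
      then show "F l = F' l" using F(3) by (cases "l = i") (auto simp: f_def I dest: fun_cong[of _ _ l])
    qed (use F in \<open>auto simp: E_def PiE_def\<close>)
  qed
  moreover have finR: "finite (R G)" for G by (simp add: R_def)
  ultimately have "card E \<le> card (Sigma ?P R)"
    using finP by (metis card_image card_mono finite_SigmaI)
  also have "\<dots> = (\<Sum>G\<in>?P. card (R G))" using finP finR by (simp add: card_SigmaI)
  finally have "real (card E) \<le> (\<Sum>G\<in>?P. real (card (R G)))" by (metis of_nat_le_iff of_nat_sum)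
  also have "\<dots> \<le> (\<Sum>G\<in>?P. (if G \<in> B then N else 0) + q * N)"
  proof (intro sum_mono)
    fix G assume "G \<in> ?P"
    then show "real (card (R G)) \<le> (if G \<in> B then N else 0) + q * N"
      using good[of G "X G"] X[of G] q by (auto simp: R_def N_def)
  qed
  also have "\<dots> = card B * N + card ?P * (q * N)"
  proof -
    have "?P \<inter> {G. G \<in> B} = B" using BI by blast
    then show ?thesis using finP by (simp add: sum.distrib sum.If_cases)
  qed
  also have "real (card ?P) = N ^ (n - 1)" using finI by (simp add: card_PiE N_def)
  also have "card B * N + N ^ (n - 1) * (q * N) \<le> \<beta> * N ^ (n - 1) * N + N ^ (n - 1) * (q * N)"
    using \<beta> by (intro add_right_mono mult_right_mono) (auto simp: N_def)
  also have "\<dots> = (\<beta> + q) * (N ^ (n - 1) * N)" by (simp add: algebra_simps)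
  also have "N ^ (n - 1) * N = N ^ n" using i by (metis less_nat_zero_code mult.commute neq0_conv power_minus_mult)
  finally show ?thesis by (simp add: E_def N_def)
qed

text \<open>A union bound over the exceptional row. The relation between \<open>A\<close> and
  \<open>D\<close> says that all frequencies used at scale t = 2 \<eta> sqrt n are at most D, hence
  covered by \<open>bad_rows\<close>.\<close>

lemma prob_least_singular_value_le:
  fixes n :: nat and \<eta> \<beta> K \<theta>0 D A :: real
  assumes n: "even n" "n > 0" and \<eta>: "\<eta> > 0" and \<theta>0: "\<theta>0 \<ge> 0" and A: "A \<ge> 0" "A / (4 * pi * \<eta> * sqrt n) \<le> D"
    and \<beta>: "\<And>i. i < n \<Longrightarrow> card (bad_rows n ({..<n} - {i}) K \<theta>0 D) \<le> \<beta> * real (card (half_sets n)) ^ (n - 1)"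
  shows "measure_pmf.prob (pmf_of_set (row_regular_mats n)) {Q. least_singular_value Q \<le> \<eta>}
     \<le> n * (\<beta> + 2 * (4 * pi * \<eta> * sqrt n * \<theta>0 + n * exp (-K) + 2 * exp (-A)))"
proof -
  let ?H = "half_sets n"
  define t where "t = 2 * \<eta> * sqrt n"
  define q where "q = 2 * (4 * pi * \<eta> * sqrt n * \<theta>0 + n * exp (-K) + 2 * exp (-A))"
  have t: "t > 0" using \<eta> n by (simp add: t_def)
  have q: "q \<ge> 0" unfolding q_def using \<eta> \<theta>0 by (intro mult_nonneg_nonneg add_nonneg_nonneg) auto
  define E where "E i = {F \<in> {..<n} \<rightarrow>\<^sub>E ?H. \<forall>x::nat \<Rightarrow> real. (\<Sum>j<n. (x j)\<^sup>2) = 1 \<longrightarrow>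
     (\<forall>l\<in>{..<n} - {i}. sum x (F l) = 0) \<longrightarrow> \<bar>sum x (F i)\<bar> \<le> t}" for i
  have cE: "card (E i) \<le> (\<beta> + q) * real (card ?H) ^ n" if i: "i < n" for i
    unfolding E_def
  proof (rule card_row_event_le[OF i refl \<beta>[OF i] _ q])
    show "bad_rows n ({..<n} - {i}) K \<theta>0 D \<subseteq> ({..<n} - {i}) \<rightarrow>\<^sub>E ?H" by (auto simp: bad_rows_def)
    fix G :: "nat \<Rightarrow> nat set" and x :: "nat \<Rightarrow> real"
    assume G: "G \<in> (({..<n} - {i}) \<rightarrow>\<^sub>E ?H) - bad_rows n ({..<n} - {i}) K \<theta>0 D"
      and x: "(\<Sum>j<n. (x j)\<^sup>2) = 1" "\<forall>l\<in>{..<n} - {i}. sum x (G l) = 0"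
    have "smooth_conc n t x 0 \<le> 2 * pi * t * \<theta>0 + n * exp (-K) + 2 * exp (-A)"
    proof (rule smooth_conc_le[OF n t A(1) \<theta>0])
      fix v assume v: "\<theta>0 \<le> v" "v \<le> A / (2 * pi * t)"
      have "v \<le> D" using v(2) A(2) by (simp add: t_def mult_ac)
      then show "\<not> near n K (\<lambda>j. v * x j)" using G x v(1) unfolding bad_rows_def by blast
    qed
    then have "2 * smooth_conc n t x 0 \<le> q" by (simp add: q_def t_def mult_ac)
    then have "2 * smooth_conc n t x 0 * card ?H \<le> q * card ?H" by (intro mult_right_mono) auto
    then show "card {S \<in> ?H. \<bar>sum x S\<bar> \<le> t} \<le> q * card ?H"
      using small_ball_le_smooth_conc[OF t, of n x] by linarith
  qed
  have "{F \<in> {..<n} \<rightarrow>\<^sub>E ?H. least_singular_value (mat_of_rows_sets n F) \<le> \<eta>} \<subseteq> (\<Union>i\<in>{..<n}. E i)"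
  proof
    fix F assume "F \<in> {F \<in> {..<n} \<rightarrow>\<^sub>E ?H. least_singular_value (mat_of_rows_sets n F) \<le> \<eta>}"
    then have F: "F \<in> {..<n} \<rightarrow>\<^sub>E ?H" "least_singular_value (mat_of_rows_sets n F) \<le> \<eta>" by auto
    have row: "(\<Sum>j<n. mat_of_rows_sets n F $$ (l, j) * x j) = sum x (F l)" if "l < n" for l and x :: "nat \<Rightarrow> real"
    proof -
      have "F l \<in> ?H" using F(1) that by auto
      then show ?thesis by (intro sum_row_mat_of_rows_sets that half_sets_subset)
    qed
    have "mat_of_rows_sets n F \<in> carrier_mat n n" by (simp add: mat_of_rows_sets_def)
    from least_singular_value_row[OF this n(2) \<eta> F(2)]
    obtain i where i: "i < n" and *: "\<And>x::nat \<Rightarrow> real. (\<Sum>j<n. (x j)\<^sup>2) = 1 \<Longrightarrow>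
       (\<forall>l<n. l \<noteq> i \<longrightarrow> (\<Sum>j<n. mat_of_rows_sets n F $$ (l, j) * x j) = 0)
       \<Longrightarrow> \<bar>\<Sum>j<n. mat_of_rows_sets n F $$ (i, j) * x j\<bar> \<le> 2 * \<eta> * sqrt n" by blast
    have "F \<in> E i" unfolding E_def using F(1) *[unfolded row[OF i]] row by (auto simp: t_def)
    then show "F \<in> (\<Union>i\<in>{..<n}. E i)" using i by blast
  qed
  moreover have finE: "finite (E i)" for i
  proof (rule finite_subset)
    show "E i \<subseteq> {..<n} \<rightarrow>\<^sub>E ?H" unfolding E_def by blast
    show "finite ({..<n} \<rightarrow>\<^sub>E ?H)" by (intro finite_PiE) auto
  qed
  ultimately have "card {F \<in> {..<n} \<rightarrow>\<^sub>E ?H. least_singular_value (mat_of_rows_sets n F) \<le> \<eta>} \<le> card (\<Union>i\<in>{..<n}. E i)"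
    by (intro card_mono) auto
  also have "\<dots> \<le> (\<Sum>i\<in>{..<n}. card (E i))" by (intro card_UN_le) auto
  finally have "real (card {F \<in> {..<n} \<rightarrow>\<^sub>E ?H. least_singular_value (mat_of_rows_sets n F) \<le> \<eta>})
     \<le> (\<Sum>i\<in>{..<n}. real (card (E i)))" unfolding of_nat_sum[symmetric] by (simp only: of_nat_le_iff)
  also have "\<dots> \<le> (\<Sum>i\<in>{..<n}. (\<beta> + q) * real (card ?H) ^ n)" by (rule sum_mono, rule cE) simp
  also have "\<dots> = n * (\<beta> + q) * real (card ?H) ^ n" by simp
  finally show ?thesis
    unfolding prob_row_regular[OF n(1)] q_def[symmetric] using card_half_sets_pos[of n]
    by (subst pos_divide_le_eq) auto
qed

section \<open>Choice of parameters\<close>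

lemma power_nat_ceiling_le_powr:
  fixes a x :: real
  assumes "a \<ge> 1" "x \<ge> 0"
  shows "a ^ nat \<lceil>x\<rceil> \<le> a powr (x + 1)"
proof -
  have "a ^ nat \<lceil>x\<rceil> = a powr real (nat \<lceil>x\<rceil>)" using assms by (subst powr_realpow) auto
  also have "\<dots> \<le> a powr (x + 1)" using assms by (intro powr_mono) linarith+
  finally show ?thesis .
qed

lemma card_bad_rows_asymp:
  "\<forall>\<^sub>F n::nat in sequentially. even n \<longrightarrow> (\<forall>i<n.
     card (bad_rows n ({..<n} - {i}) (real n powr 0.001) (real n powr 0.08) (2 powr (real n powr 0.0002)))
     \<le> 2 powr (- (real n powr 0.0001)) * real (card (half_sets n)) ^ (n - 1))"
proof -
  \<comment> \<open>The flat case, with d = n^0.43, L = n^0.47, r = n^0.46. As d is below L by a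
    power of n, w stays spread; L^2 = n^0.94 and n L d / r^2 = n^0.98 are both below n by a power of
    n, so (7/8)^(n - 1) wins; and r sqrt K is below L by a power of n.\<close>
  have "\<forall>\<^sub>F n::nat in sequentially. real n powr 0.43 \<le> sqrt n"
    "\<forall>\<^sub>F n::nat in sequentially. real n powr 0.47 / 5 \<le> 2 / 5 * real n powr 0.47 - sqrt (2 * (real n powr 0.47 * real n powr 0.43))"
    "\<forall>\<^sub>F n::nat in sequentially. 6 * pi * real n powr 0.46 * sqrt (real n powr 0.001) / (real n powr 0.47 / 5)
       + real n * exp (- (real n powr 0.001)) \<le> 1/4"
    by real_asymp+
  moreover have "\<forall>\<^sub>F n::nat in sequentially.
     (2 * real n + 1) powr (4 * (real n powr 0.47 * real n powr 0.43) + 20 * (real n powr 0.47)\<^sup>2 + 1)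
     * (2 * (real n powr 0.47 * sqrt n + 2) + 1)
     * (exp ((4 * real n * (real n powr 0.47 * real n powr 0.43) + 2 * real n) / (real n powr 0.46)\<^sup>2) * (7/8) ^ (n - 1))
     \<le> 2 powr (- (real n powr 0.0001)) / 2"
    by real_asymp
  \<comment> \<open>The structured case. Here sqrt V is about n^0.25, so g has order n^(0.25 + 0.08
    - 0.42), about n^(-0.09). The Fourier errors are small against 1 / D because sqrt K = n^0.0005
    exceeds n^0.0002.\<close>
  moreover have "\<forall>\<^sub>F n::nat in sequentially. sqrt (real n * real n powr 0.001) \<ge> 1"
    "\<forall>\<^sub>F n::nat in sequentially. real n powr 0.001 \<le> sqrt (real n * real n powr 0.001)"
    "\<forall>\<^sub>F n::nat in sequentially. sqrt (2 * sqrt (real n * real n powr 0.001)) \<le> sqrt n / 2"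
    "\<forall>\<^sub>F n::nat in sequentially. real n * exp (- (real n powr 0.001 / 4)) + 2 * exp (- sqrt (real n powr 0.001))
       \<le> sqrt (sqrt (real n * real n powr 0.001)) * real n powr 0.08 / 2 powr (real n powr 0.0002)"
    "\<forall>\<^sub>F n::nat in sequentially. 8 * sqrt (sqrt (real n * real n powr 0.001)) * real n powr 0.08
       * (1 + 2 * sqrt n / real n powr 0.42) / sqrt n \<le> real n powr (-0.05)"
    "\<forall>\<^sub>F n::nat in sequentially. 2 * (1 + ln (2 powr (real n powr 0.0002) + 2 * sqrt n + 1 + 1)) \<le> real n powr 0.01"
    by real_asymp+
  \<comment> \<open>The powers of n leave n^(-0.04 n), which beats exp (6 n), the single factor of
    order D and the target.\<close>
  moreover have "\<forall>\<^sub>F n::nat in sequentially. (2 * real n + 1) * exp (6 * real n)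
     * ((real n powr (-0.05)) ^ (n - 1) * (1 + (2 powr (real n powr 0.0002) + 2 * sqrt n + 1)) * (real n powr 0.01) ^ n)
     \<le> 2 powr (- (real n powr 0.0001)) / 2"
    by real_asymp
  \<comment> \<open>The two cases cover everything: V / \<theta>0 is about n^0.4205 and \<theta>1 =
    n^0.42, both below d = n^0.43.\<close>
  moreover have "\<forall>\<^sub>F n::nat in sequentially. (sqrt (real n * real n powr 0.001) + 8 * real n powr 0.001) / real n powr 0.08
     + 8 * real n powr 0.42 \<le> real n powr 0.43"
    "\<forall>\<^sub>F n::nat in sequentially. n \<ge> 2"
    by (real_asymp, rule eventually_ge_at_top)
  ultimately show ?thesis
  proof eventually_elim
    case (elim n)
    note c = elim
    define K \<theta>0 \<theta>1 D L d r where "K = real n powr 0.001" and "\<theta>0 = real n powr 0.08" and "\<theta>1 = real n powr 0.42"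
      and "D = 2 powr (real n powr 0.0002)" and "L = real n powr 0.47" and "d = real n powr 0.43" and "r = real n powr 0.46"
    note defs = K_def \<theta>0_def \<theta>1_def D_def L_def d_def r_def
    note c = c[folded defs]
    have n: "n > 0" "real n \<ge> 1" using c by auto
    have pos: "K > 0" "\<theta>0 > 0" "\<theta>1 > 0" "D > 0" "L > 0" "d > 0" "r > 0" using n by (auto simp: defs)
    have "\<theta>0 \<le> \<theta>1" using n unfolding defs by (intro powr_mono) auto
    define V where "V = sqrt (n * K)"
    define \<tau> where "\<tau> = 2 powr (- (real n powr 0.0001))"
    show ?case
    proof (intro impI allI)
      fix i assume ev: "even n" and i: "i < n"
      let ?I = "{..<n} - {i}"
      define N where "N = real (card (half_sets n)) ^ (n - 1)"
      have I: "finite ?I" "card ?I = n - 1" using i by auto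
      have I_ne: "?I \<noteq> {}"
      proof -
        have "card ?I > 0" using I c by simp
        then show ?thesis by (metis card.empty less_irrefl)
      qed
      have N0: "N \<ge> 0" by (simp add: N_def)
      have flat: "card (flat_kernel n ?I d) \<le> \<tau> / 2 * N"
      proof -
        let ?x = "4 * (L * d) + 20 * L\<^sup>2"
        define m where "m = nat \<lceil>?x\<rceil>"
        define p where "p = nat \<lceil>L * sqrt n + 1\<rceil>"
        have x0: "?x \<ge> 0" using pos by (intro add_nonneg_nonneg mult_nonneg_nonneg) auto
        have p: "L * sqrt n + 1 \<le> p" "p \<le> L * sqrt n + 2"
        proof -
          have "L * sqrt n + 1 \<ge> 0" using pos by (intro add_nonneg_nonneg mult_nonneg_nonneg) auto
          then show "L * sqrt n + 1 \<le> p" "p \<le> L * sqrt n + 2" unfolding p_def by linarith+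
        qed
        have "card (flat_kernel n ?I d) \<le> (2 * real n + 1) ^ m * (2 * real p + 1)
           * (exp ((4 * real n * (L * d) + 2 * real n) / r\<^sup>2) * (7/8 * card (half_sets n)) ^ card ?I)"
        proof (rule card_flat_kernel_le[OF ev n(1) I(1) _ I_ne pos(5,6) c(1) pos(7) pos(1) _ c(2,3)])
          show "card ?I \<le> n" using I by simp
          show "L / 5 > 0" using pos by simp
          show "?x \<le> m" using x0 unfolding m_def by linarith
          show "L * sqrt n + 1 \<le> p" by (rule p)
        qed
        also have "\<dots> = ((2 * real n + 1) ^ m * (2 * real p + 1)
           * (exp ((4 * real n * (L * d) + 2 * real n) / r\<^sup>2) * (7/8) ^ (n - 1))) * N"
          by (simp only: I power_mult_distrib N_def mult.assoc)
        also have "\<dots> \<le> ((2 * real n + 1) powr (?x + 1) * (2 * (L * sqrt n + 2) + 1)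
           * (exp ((4 * real n * (L * d) + 2 * real n) / r\<^sup>2) * (7/8) ^ (n - 1))) * N"
          using p N0 x0 unfolding m_def
          by (intro mult_right_mono mult_mono power_nat_ceiling_le_powr) auto
        also have "\<dots> \<le> \<tau> / 2 * N" using c(4) N0 unfolding \<tau>_def by (intro mult_right_mono)
        finally show ?thesis .
      qed
      have struct: "card (structured_kernel n ?I K \<theta>0 \<theta>1 D) \<le> \<tau> / 2 * N"
      proof -
        define m where "m = nat \<lceil>D + 2 * sqrt n\<rceil>"
        have m: "D + 2 * sqrt n \<le> m" "m \<le> D + 2 * sqrt n + 1"
        proof -
          have "D + 2 * sqrt n \<ge> 0" using pos by simp
          then show "D + 2 * sqrt n \<le> m" "m \<le> D + 2 * sqrt n + 1" unfolding m_def by linarith+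
        qed
        define g where "g = 8 * sqrt V * \<theta>0 * (1 + 2 * sqrt n / \<theta>1) / sqrt n"
        have g0: "g \<ge> 0" unfolding g_def V_def using pos
          by (intro divide_nonneg_nonneg mult_nonneg_nonneg add_nonneg_nonneg) auto
        have l0: "0 \<le> 2 * (1 + ln (real m + 1))" by simp
        have "card (structured_kernel n ?I K \<theta>0 \<theta>1 D) \<le> (2 * real n + 1) * exp (6 * real n)
           * (g ^ (n - 1) * (1 + real m) * (2 * (1 + ln (real m + 1))) ^ n) * N"
          unfolding N_def
          by (rule card_structured_kernel_le[OF ev n(1) I pos(1) V_def _ _ _ pos(2-4) _ m(1) g_def])
             (use c in \<open>simp_all add: V_def\<close>)
        also have "\<dots> \<le> (2 * real n + 1) * exp (6 * real n)
           * ((real n powr (-0.05)) ^ (n - 1) * (1 + (D + 2 * sqrt n + 1)) * (real n powr 0.01) ^ n) * N"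
        proof (intro mult_right_mono mult_left_mono mult_mono power_mono)
          show "g \<le> real n powr (-0.05)" using c(9) by (simp add: g_def V_def)
          have "ln (real m + 1) \<le> ln (D + 2 * sqrt n + 1 + 1)" using m by simp
          then have "2 * (1 + ln (real m + 1)) \<le> 2 * (1 + ln (D + 2 * sqrt n + 1 + 1))"
            by (intro mult_left_mono add_left_mono) auto
          then show "2 * (1 + ln (real m + 1)) \<le> real n powr 0.01" using c(10) by (rule order.trans)
        qed (use m g0 l0 N0 pos in \<open>auto intro!: mult_nonneg_nonneg\<close>)
        also have "\<dots> \<le> \<tau> / 2 * N" using c(11) N0 unfolding \<tau>_def by (intro mult_right_mono)
        finally show ?thesis .
      qed
      have "bad_rows n ?I K \<theta>0 D \<subseteq> flat_kernel n ?I d \<union> structured_kernel n ?I K \<theta>0 \<theta>1 D"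
        using c(12) pos \<open>\<theta>0 \<le> \<theta>1\<close> by (intro bad_rows_subset) auto
      moreover have fin: "finite (flat_kernel n ?I d)" "finite (structured_kernel n ?I K \<theta>0 \<theta>1 D)"
      proof -
        have "finite (?I \<rightarrow>\<^sub>E half_sets n)" using I by (intro finite_PiE) auto
        then show "finite (flat_kernel n ?I d)" "finite (structured_kernel n ?I K \<theta>0 \<theta>1 D)"
          by (auto simp: flat_kernel_def structured_kernel_def intro: finite_subset)
      qed
      ultimately have "card (bad_rows n ?I K \<theta>0 D) \<le> card (flat_kernel n ?I d \<union> structured_kernel n ?I K \<theta>0 \<theta>1 D)"
        by (intro card_mono) auto
      also have "\<dots> \<le> card (flat_kernel n ?I d) + card (structured_kernel n ?I K \<theta>0 \<theta>1 D)" by (rule card_Un_le)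
      finally have "real (card (bad_rows n ?I K \<theta>0 D)) \<le> \<tau> / 2 * N + \<tau> / 2 * N" using flat struct by linarith
      then show "card (bad_rows n ?I (real n powr 0.001) (real n powr 0.08) (2 powr (real n powr 0.0002)))
         \<le> 2 powr (- (real n powr 0.0001)) * real (card (half_sets n)) ^ (n - 1)"
        by (simp add: N_def \<tau>_def defs mult.commute)
    qed
  qed
qed

theorem theorem1p3:
  shows "\<exists>C::real. C > 0 \<and>
    (\<forall>n::nat. even n \<and> n > 0 \<longrightarrow>
      (\<forall>\<eta>::real. \<eta> \<ge> 2 powr (- (real n powr 0.0001)) \<longrightarrow>
        measure_pmf.prob (pmf_of_set (row_regular_mats n)) {Q. least_singular_value Q \<le> \<eta>}
          \<le> C * \<eta> * (real n)\<^sup>2))"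
proof -
  \<comment> \<open>The first bound lets n^2 absorb n sqrt n \<theta>0. In the others n^0.0002 and
    sqrt K = n^0.0005 both exceed n^0.0001, so all frequencies up to A / (4 pi \<eta> sqrt n) are at
    most D and the Fourier errors are below \<eta>.\<close>
  have "\<forall>\<^sub>F n::nat in sequentially. real n powr 0.08 \<le> sqrt n"
    "\<forall>\<^sub>F n::nat in sequentially. sqrt (real n powr 0.001) / (4 * pi * 2 powr (- (real n powr 0.0001)) * sqrt n)
       \<le> 2 powr (real n powr 0.0002)"
    "\<forall>\<^sub>F n::nat in sequentially. 2 * (real n * exp (- (real n powr 0.001)) + 2 * exp (- sqrt (real n powr 0.001)))
       \<le> 2 powr (- (real n powr 0.0001))"
    by real_asymp+
  with card_bad_rows_asymp
  have "\<forall>\<^sub>F n::nat in sequentially. even n \<and> n > 0 \<longrightarrow>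
      (\<forall>\<eta>::real. \<eta> \<ge> 2 powr (- (real n powr 0.0001)) \<longrightarrow>
        measure_pmf.prob (pmf_of_set (row_regular_mats n)) {Q. least_singular_value Q \<le> \<eta>} \<le> 34 * \<eta> * (real n)\<^sup>2)"
  proof eventually_elim
    case (elim n)
    show ?case
    proof (intro impI allI)
      fix \<eta> :: real
      define \<tau> where "\<tau> = 2 powr (- (real n powr 0.0001))"
      assume n: "even n \<and> n > 0" and \<eta>: "\<eta> \<ge> 2 powr (- (real n powr 0.0001))"
      define K \<theta>0 A D where "K = real n powr 0.001" and "\<theta>0 = real n powr 0.08" and "A = sqrt (real n powr 0.001)"
        and "D = 2 powr (real n powr 0.0002)"
      have \<tau>: "0 < \<tau>" "\<tau> \<le> \<eta>" using \<eta> by (simp_all add: \<tau>_def)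
      have n1: "real n \<ge> 1" using n by simp
      have "measure_pmf.prob (pmf_of_set (row_regular_mats n)) {Q. least_singular_value Q \<le> \<eta>}
         \<le> n * (\<tau> + 2 * (4 * pi * \<eta> * sqrt n * \<theta>0 + n * exp (-K) + 2 * exp (-A)))"
      proof (rule prob_least_singular_value_le[where D = D])
        have "A / (4 * pi * \<eta> * sqrt n) \<le> A / (4 * pi * \<tau> * sqrt n)"
          using \<tau> n by (intro divide_left_mono mult_mono mult_pos_pos) (auto simp: A_def)
        also have "\<dots> \<le> D" using elim(3) by (simp add: A_def \<tau>_def D_def)
        finally show "A / (4 * pi * \<eta> * sqrt n) \<le> D" .
        show "card (bad_rows n ({..<n} - {i}) K \<theta>0 D) \<le> \<tau> * real (card (half_sets n)) ^ (n - 1)" if "i < n" for i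
          using elim(1) n that unfolding K_def \<theta>0_def D_def \<tau>_def by blast
      qed (use n \<tau> in \<open>auto simp: \<theta>0_def A_def\<close>)
      also have "\<dots> = n * (\<tau> + 8 * pi * \<eta> * (sqrt n * \<theta>0) + 2 * (n * exp (-K) + 2 * exp (-A)))"
        by (simp add: algebra_simps)
      also have "\<dots> \<le> n * (\<eta> + 8 * pi * \<eta> * n + \<eta>)"
      proof (intro mult_left_mono add_mono)
        have "sqrt n * \<theta>0 \<le> sqrt n * sqrt n" using elim(2) by (intro mult_left_mono) (auto simp: \<theta>0_def)
        then show "sqrt n * \<theta>0 \<le> n" by simp
        show "2 * (n * exp (-K) + 2 * exp (-A)) \<le> \<eta>"
          using elim(4) \<eta> by (simp add: K_def A_def)
      qed (use \<tau> in auto)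
      \<comment> \<open>The constant is 34 = 8 * 4 + 2, from pi < 4 and n \<ge> 1.\<close>
      also have "\<dots> \<le> n * (34 * \<eta> * n)"
      proof (intro mult_left_mono)
        have "pi * (\<eta> * n) \<le> 4 * (\<eta> * n)" using pi_less_4 \<tau> by (intro mult_right_mono) auto
        moreover have "\<eta> * 1 \<le> \<eta> * n" using n1 \<tau> by (intro mult_left_mono) auto
        ultimately show "\<eta> + 8 * pi * \<eta> * n + \<eta> \<le> 34 * \<eta> * n" by (simp add: mult.assoc)
      qed auto
      also have "\<dots> = 34 * \<eta> * (real n)\<^sup>2" by (simp add: power2_eq_square)
      finally show "measure_pmf.prob (pmf_of_set (row_regular_mats n)) {Q. least_singular_value Q \<le> \<eta>} \<le> 34 * \<eta> * (real n)\<^sup>2" .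
    qed
  qed
  then obtain n0 :: nat where n0: "\<And>n \<eta>. n \<ge> n0 \<Longrightarrow> even n \<Longrightarrow> n > 0 \<Longrightarrow> \<eta> \<ge> 2 powr (- (real n powr 0.0001)) \<Longrightarrow>
      measure_pmf.prob (pmf_of_set (row_regular_mats n)) {Q. least_singular_value Q \<le> \<eta>} \<le> 34 * \<eta> * (real n)\<^sup>2"
    unfolding eventually_sequentially by blast
  \<comment> \<open>For n < n0 the hypothesis forces \<eta> \<ge> 2^(- n0), so C \<eta> \<ge> 1 and
    the bound on the probability is trivial.\<close>
  define C where "C = max 34 (2 powr real n0)"
  have "measure_pmf.prob (pmf_of_set (row_regular_mats n)) {Q. least_singular_value Q \<le> \<eta>} \<le> C * \<eta> * (real n)\<^sup>2"
    if n: "even n" "n > 0" and \<eta>: "\<eta> \<ge> 2 powr (- (real n powr 0.0001))" for n :: nat and \<eta> :: real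
  proof -
    have \<eta>0: "\<eta> > 0" using \<eta> by (rule less_le_trans[rotated]) simp
    show ?thesis
    proof (cases "n \<ge> n0")
      case True
      have "34 * \<eta> * (real n)\<^sup>2 \<le> C * \<eta> * (real n)\<^sup>2"
        using \<eta>0 by (intro mult_right_mono) (auto simp: C_def)
      then show ?thesis using n0[OF True n \<eta>] by linarith
    next
      case False
      have n1: "real n \<ge> 1" using n by simp
      have "real n powr 0.0001 \<le> real n powr 1" using n1 by (intro powr_mono) auto
      also have "\<dots> \<le> real n0" using False by simp
      finally have "2 powr (- real n0) \<le> \<eta>"
        using \<eta> by (intro order.trans[OF _ \<eta>] powr_mono) auto
      then have "2 powr real n0 * 2 powr (- real n0) \<le> C * \<eta>"
        by (intro mult_mono) (auto simp: C_def)
      then have "1 \<le> C * \<eta>" by (simp add: powr_minus)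
      moreover have "1 \<le> (real n)\<^sup>2" using n1 by simp
      ultimately have "1 * 1 \<le> C * \<eta> * (real n)\<^sup>2" by (intro mult_mono) auto
      then show ?thesis using measure_pmf.prob_le_1[of "pmf_of_set (row_regular_mats n)" "{Q. least_singular_value Q \<le> \<eta>}"]
        by linarith
    qed
  qed
  moreover have "C > 0" by (simp add: C_def less_max_iff_disj)
  ultimately show ?thesis by blast
qed

end
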